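(* Let $H$ be a connected graph with $e(H) - v(H) \leq 4$. Then $R(H,K_n) = O(n^3)$, i.e. there is a constant $C = C(H)$ such that $R(H,K_n) \leq C n^3$ for all $n \geq 1$.
   Context: For graphs $H$ and $F$, the Ramsey number $R(H,F)$ is the smallest $N$ such that for every graph $G$ on $N$ vertices, either $G$ contains a copy of $H$ (as a subgraph) or its complement $\overline{G}$ contains a copy of $F$. Here $e(H)$ and $v(H)$ denote the numbers of edges and vertices of $H$, and $K_n$ is the complete graph on $n$ vertices. *)

theory Defs
  imports "Graph_Theory.Graph_Theory" "HOL-Library.Ramsey"
begin

text \<open>
  A finite simple graph is a \<^locale>\<open>pair_graph\<close>: a finite, loopless, symmetric digraph whose
  arcs are ordered pairs. An undirected edge \<open>{u, v}\<close> is thus represented by the two arcs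
  \<open>(u, v)\<close> and \<open>(v, u)\<close>, so the number of edges is the cardinality of \<open>edges\<close> below and not that
  of \<^term>\<open>parcs\<close>.
\<close>

definition edges :: "'a pair_pre_digraph \<Rightarrow> 'a set set" where
  "edges G = (\<lambda>(u, v). {u, v}) ` parcs G"

definition contains_copy :: "'a pair_pre_digraph \<Rightarrow> 'b pair_pre_digraph \<Rightarrow> bool" where
  "contains_copy G H \<longleftrightarrow>
     (\<exists>G'. subgraph (with_proj G') (with_proj G) \<and> digraph_iso (with_proj H) (with_proj G'))"

definition complement :: "'a pair_pre_digraph \<Rightarrow> 'a pair_pre_digraph" where
  "complement G = \<lparr>pverts = pverts G,
     parcs = {(u, v). u \<in> pverts G \<and> v \<in> pverts G \<and> u \<noteq> v \<and> (u, v) \<notin> parcs G}\<rparr>"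

definition complete_graph :: "nat \<Rightarrow> nat pair_pre_digraph" where
  "complete_graph n = \<lparr>pverts = {..<n}, parcs = {(u, v). u < n \<and> v < n \<and> u \<noteq> v}\<rparr>"

definition ramsey_property :: "'a pair_pre_digraph \<Rightarrow> 'b pair_pre_digraph \<Rightarrow> nat \<Rightarrow> bool" where
  "ramsey_property H F N \<longleftrightarrow>
     (\<forall>G :: nat pair_pre_digraph. pair_graph G \<and> card (pverts G) = N \<longrightarrow>
        contains_copy G H \<or> contains_copy (complement G) F)"

text \<open>
  The graphs \<open>G\<close> above have natural numbers as vertices; by \<open>ramsey_property_any_type\<close> below this
  loses no generality. The minimum exists by \<open>ramsey_property_ex\<close>.
\<close>

definition ramsey_number :: "'a pair_pre_digraph \<Rightarrow> 'b pair_pre_digraph \<Rightarrow> nat" where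
  "ramsey_number H F = (LEAST N. ramsey_property H F N)"


lemma pair_graphI:
  assumes "finite (pverts G)" "parcs G \<subseteq> pverts G \<times> pverts G"
    and "\<And>u v. (u, v) \<in> parcs G \<Longrightarrow> u \<noteq> v" "\<And>u v. (u, v) \<in> parcs G \<Longrightarrow> (v, u) \<in> parcs G"
  shows "pair_graph G"
proof -
  have "finite (parcs G)"
    using assms(1,2) finite_subset by blast
  then show ?thesis
    using assms by unfold_locales (auto simp: symmetric_def intro!: symI)
qed

lemma pair_graph_complement: "pair_graph G \<Longrightarrow> pair_graph (complement G)"
proof -
  assume "pair_graph G"
  then interpret pair_graph G .
  show ?thesis
    using pair_finite_verts arcs_symmetric
    by (intro pair_graphI) (auto simp: complement_def)
qed

lemma complete_digraph_complete_graph: "complete_digraph n (with_proj (complete_graph n))"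
  by (auto simp: complete_digraph_pair_def complete_graph_def)

lemma contains_copy_iff_inj:
  assumes G: "pair_graph G" and H: "pair_graph H"
  shows "contains_copy G H \<longleftrightarrow>
    (\<exists>f. inj_on f (pverts H) \<and> f ` pverts H \<subseteq> pverts G \<and>
         (\<forall>u v. (u, v) \<in> parcs H \<longrightarrow> (f u, f v) \<in> parcs G))" (is "_ \<longleftrightarrow> ?R")
proof
  interpret G: pair_graph G by fact
  interpret H: pair_graph H by fact
  show ?R if "contains_copy G H"
  proof -
    from that obtain G' h where *: "subgraph (with_proj G') (with_proj G)"
      "pre_digraph.digraph_isomorphism (with_proj H) h"
      "with_proj G' = app_iso h (with_proj H)"
      by (auto simp: contains_copy_def digraph_iso_def)
    have V: "pverts G' = iso_verts h ` pverts H" and A: "parcs G' = iso_arcs h ` parcs H"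
      and T: "fst = iso_tail h" "snd = iso_head h"
      using *(3) by (simp_all add: app_iso_def with_proj_def)
    have "(iso_verts h u, iso_verts h v) \<in> parcs G" if "(u, v) \<in> parcs H" for u v
    proof -
      have "fst (iso_arcs h (u, v)) = iso_verts h u" "snd (iso_arcs h (u, v)) = iso_verts h v"
        using *(2) that by (auto simp: pre_digraph.digraph_isomorphism_def T)
      then have "iso_arcs h (u, v) = (iso_verts h u, iso_verts h v)"
        by (metis prod.collapse)
      moreover have "iso_arcs h (u, v) \<in> parcs G"
        using that A *(1) by (auto simp: subgraph_def)
      ultimately show ?thesis by simp
    qed
    then show ?R
      using *(1,2) V
      by (intro exI[of _ "iso_verts h"]) (auto simp: subgraph_def pre_digraph.digraph_isomorphism_def)
  qed
  show "contains_copy G H" if ?R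
  proof -
    from that obtain f where f: "inj_on f (pverts H)" "f ` pverts H \<subseteq> pverts G"
      "\<And>u v. (u, v) \<in> parcs H \<Longrightarrow> (f u, f v) \<in> parcs G" by blast
    define G' where "G' = \<lparr>pverts = f ` pverts H, parcs = map_prod f f ` parcs H\<rparr>"
    define h where "h = \<lparr>iso_verts = f, iso_arcs = map_prod f f, iso_head = snd, iso_tail = fst\<rparr>"
    have sub: "parcs H \<subseteq> pverts H \<times> pverts H"
      using H.in_arcsD1 H.in_arcsD2 by auto
    have "inj_on (map_prod f f) (parcs H)"
      using map_prod_inj_on[OF f(1) f(1)] sub by (rule inj_on_subset)
    then have "pre_digraph.digraph_isomorphism (with_proj H) h"
      using f(1) H.wf_digraph by (simp add: pre_digraph.digraph_isomorphism_def h_def)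
    moreover have "with_proj G' = app_iso h (with_proj H)"
      by (simp add: app_iso_def with_proj_def h_def G'_def)
    moreover have "wf_digraph (with_proj G')"
      using sub by unfold_locales (auto simp: G'_def)
    then have "subgraph (with_proj G') (with_proj G)"
      using f(2,3) G.wf_digraph by (auto simp: subgraph_def G'_def compatible_def)
    ultimately show ?thesis
      unfolding contains_copy_def digraph_iso_def by blast
  qed
qed

lemma contains_copy_trans:
  assumes "contains_copy A H" "pair_graph A" "pair_graph B" "pair_graph H"
    and g: "inj_on g (pverts A)" "g ` pverts A \<subseteq> pverts B"
      "\<And>u v. (u, v) \<in> parcs A \<Longrightarrow> (g u, g v) \<in> parcs B"
  shows "contains_copy B H"
proof -
  from assms obtain f where f: "inj_on f (pverts H)" "f ` pverts H \<subseteq> pverts A"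
    "\<And>u v. (u, v) \<in> parcs H \<Longrightarrow> (f u, f v) \<in> parcs A"
    unfolding contains_copy_iff_inj[OF assms(2,4)] by blast
  have "inj_on (g \<circ> f) (pverts H)"
    using f g by (intro comp_inj_on) (auto intro: inj_on_subset)
  moreover have "(g \<circ> f) ` pverts H \<subseteq> pverts B"
    using f(2) g(2) by auto
  ultimately show ?thesis
    using f(3) g(3) unfolding contains_copy_iff_inj[OF assms(3,4)]
    by (intro exI[of _ "g \<circ> f"]) auto
qed

lemma ramsey_property_any_type:
  fixes G :: "'c pair_pre_digraph"
  assumes "ramsey_property H F N" "pair_graph H" "pair_graph F"
    and "pair_graph G" "card (pverts G) = N"
  shows "contains_copy G H \<or> contains_copy (complement G) F"
proof -
  interpret G: pair_graph G by fact
  obtain g where "bij_betw g {..<N} (pverts G)"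
    using ex_bij_betw_nat_finite[OF G.pair_finite_verts] assms(5) by (auto simp: atLeast0LessThan)
  then have g: "inj_on g {..<N}" "g ` {..<N} = pverts G"
    by (auto simp: bij_betw_def)
  define G0 where "G0 = \<lparr>pverts = {..<N}, parcs = {(u, v). u < N \<and> v < N \<and> (g u, g v) \<in> parcs G}\<rparr>"
  have G0: "pair_graph G0"
    using G.pair_no_loops G.arcs_symmetric by (intro pair_graphI) (force simp: G0_def)+
  have "contains_copy G0 H \<or> contains_copy (complement G0) F"
    using assms(1) G0 by (simp add: ramsey_property_def G0_def)
  then show ?thesis
  proof
    assume "contains_copy G0 H"
    then have "contains_copy G H"
      using g by (rule_tac contains_copy_trans[OF _ G0 assms(4,2)]) (auto simp: G0_def)
    then show ?thesis ..
  next
    assume "contains_copy (complement G0) F"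
    then have "contains_copy (complement G) F"
      using g
      by (rule_tac contains_copy_trans[OF _ pair_graph_complement[OF G0]
            pair_graph_complement[OF assms(4)] assms(3)])
         (auto simp: G0_def complement_def inj_on_def)
    then show ?thesis ..
  qed
qed

lemma contains_copy_if_clique:
  assumes "pair_graph G" "pair_graph H" "R \<subseteq> pverts G" "card R = card (pverts H)"
    and R: "\<And>u v. \<lbrakk>u \<in> R; v \<in> R; u \<noteq> v\<rbrakk> \<Longrightarrow> (u, v) \<in> parcs G"
  shows "contains_copy G H"
proof -
  interpret G: pair_graph G by fact
  interpret H: pair_graph H by fact
  have "finite R"
    using assms(3) G.pair_finite_verts by (rule finite_subset)
  then obtain f where f: "bij_betw f (pverts H) R"
    using finite_same_card_bij[OF H.pair_finite_verts] assms(4) by metis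
  have "(f u, f v) \<in> parcs G" if "(u, v) \<in> parcs H" for u v
    using that f R H.arc_fst_in_verts[OF that] H.arc_snd_in_verts[OF that] H.pair_no_loops[OF that]
    by (auto simp: bij_betw_def inj_on_def)
  then show ?thesis
    using f assms(3) unfolding contains_copy_iff_inj[OF assms(1,2)]
    by (intro exI[of _ f]) (auto simp: bij_betw_def)
qed

lemma ramsey_property_ex:
  assumes H: "pair_graph H" and F: "pair_graph F"
  shows "\<exists>N. ramsey_property H F N"
proof -
  obtain r where r: "\<forall>(V :: nat set) E. finite V \<and> card V \<ge> r \<longrightarrow>
      (\<exists>R \<subseteq> V. card R = card (pverts H) \<and> clique R E \<or> card R = card (pverts F) \<and> indep R E)"
    using ramsey2[where 'a = nat and m = "card (pverts H)" and n = "card (pverts F)"]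
    by (elim exE conjE)
  have "contains_copy G H \<or> contains_copy (complement G) F"
    if G: "pair_graph G" and card: "card (pverts G) = r" for G :: "nat pair_pre_digraph"
  proof -
    interpret G: pair_graph G by fact
    have edge: "{u, v} \<in> edges G \<longleftrightarrow> (u, v) \<in> parcs G" for u v
      using G.arcs_symmetric by (fastforce simp: edges_def doubleton_eq_iff)
    obtain R where R: "R \<subseteq> pverts G"
      and *: "card R = card (pverts H) \<and> clique R (edges G) \<or>
           card R = card (pverts F) \<and> indep R (edges G)"
      using r[rule_format, of "pverts G" "edges G"] card G.pair_finite_verts by auto
    from * show ?thesis
    proof
      assume "card R = card (pverts H) \<and> clique R (edges G)"
      then have "contains_copy G H"
        by (intro contains_copy_if_clique[OF G H R]) (auto simp: clique_def edge)
      then show ?thesis ..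
    next
      assume "card R = card (pverts F) \<and> indep R (edges G)"
      then have "contains_copy (complement G) F"
        using R by (intro contains_copy_if_clique[OF pair_graph_complement[OF G] F, of R])
          (auto simp: indep_def edge complement_def)
      then show ?thesis ..
    qed
  qed
  then show ?thesis
    by (auto simp: ramsey_property_def)
qed

lemma ramsey_property_ramsey_number:
  "pair_graph H \<Longrightarrow> pair_graph F \<Longrightarrow> ramsey_property H F (ramsey_number H F)"
  unfolding ramsey_number_def using ramsey_property_ex by (rule LeastI_ex)

end

(* Call a graph H k-bounded if R(H, K_n) = O(n^k). Deleting a vertex costs one power of n, since a host
   graph with N vertices and no independent n-set has a vertex of degree about N / n. Leaves cost
   nothing, and graphs glued at a cut vertex are as cheap as their parts; so only 2-connected graphs
   matter, and for these deleting a vertex of degree d lowers e - v by d - 1. So e - v <= -1 gives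
   R(H, K_n) = O(n), then e - v <= 1 gives O(n^2), and a graph with e - v <= 4 is 3-bounded unless it is
   a subdivision of a cubic multigraph on 8 vertices. There one gains from vertices of degree 2 (after
   deleting a suitable vertex v): almost all pairs in a random neighbourhood have many common
   neighbours, and such vertices can be placed last. *)
theory Submission
  imports Defs
begin

text \<open>The value 4 is where plain vertex deletion stops working: deleting a vertex of degree 3
  takes e - v from 4 to 2, while the bound n^2 reaches only e - v <= 1. So one power of n has to pay
  for more than one vertex. The device is a host vertex v0 whose neighbourhood U contains few pairs
  with fewer than |V(H)| common neighbours. Remove from H a vertex v, a vertex x and a set I of
  degree-2 neighbours of x, and embed the rest in U together with an image of x; then v goes to v0,
  and I is filled in greedily at the very end. Together v, x and I cost one power. The rest must be
  2-bounded, and the work lies in choosing v and x so that it is. A cubic graph on 8 vertices has no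
  vertices of degree 2, so one vertex is first deleted at full price to create them; then the rest
  must be 1-bounded, that is, in effect a forest. If no suitable star is present, a degree-2 vertex
  whose two neighbours are adjacent serves instead, because edges in few triangles are rare.\<close>

locale sgraph =
  fixes E :: "'a \<Rightarrow> 'a \<Rightarrow> bool"
  assumes sym: "E u v \<Longrightarrow> E v u"
    and irrefl: "\<not> E u u"

definition nbh :: "('a \<Rightarrow> 'a \<Rightarrow> bool) \<Rightarrow> 'a set \<Rightarrow> 'a \<Rightarrow> 'a set" where
  "nbh E V v = {u \<in> V. E v u}"

definition indep_free :: "('a \<Rightarrow> 'a \<Rightarrow> bool) \<Rightarrow> nat \<Rightarrow> 'a set \<Rightarrow> bool" where
  "indep_free A n W \<longleftrightarrow> finite W \<and> (\<forall>S\<subseteq>W. card S = n \<longrightarrow> (\<exists>u\<in>S. \<exists>v\<in>S. A u v))"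

definition is_emb :: "('a \<Rightarrow> 'a \<Rightarrow> bool) \<Rightarrow> 'a set \<Rightarrow> ('b \<Rightarrow> 'b \<Rightarrow> bool) \<Rightarrow> 'b set \<Rightarrow> ('a \<Rightarrow> 'b) \<Rightarrow> bool" where
  "is_emb E V A W g \<longleftrightarrow> inj_on g V \<and> g ` V \<subseteq> W \<and> (\<forall>u\<in>V. \<forall>v\<in>V. E u v \<longrightarrow> A (g u) (g v))"

text \<open>A pattern is a fixed relation \<open>E\<close> together with a vertex set, so passing to
  an induced subgraph changes only the set. The threshold is a lower bound on \<open>card W\<close>,
  which lets unsuitable host vertices be discarded before embedding.\<close>

definition ramsey_bounded :: "('a \<Rightarrow> 'a \<Rightarrow> bool) \<Rightarrow> nat \<Rightarrow> 'a set \<Rightarrow> bool" where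
  "ramsey_bounded E k V \<longleftrightarrow> (\<exists>C. \<forall>n\<ge>1. \<forall>(A :: nat \<Rightarrow> nat \<Rightarrow> bool) W.
     sgraph A \<longrightarrow> indep_free A n W \<longrightarrow> C * n ^ k \<le> card W \<longrightarrow> (\<exists>g. is_emb E V A W g))"

lemma nbh_subset: "nbh E V v \<subseteq> V"
  by (auto simp: nbh_def)

lemma finite_nbh: "finite V \<Longrightarrow> finite (nbh E V v)"
  by (simp add: nbh_def)

lemma indep_free_subset: "indep_free A n W \<Longrightarrow> W' \<subseteq> W \<Longrightarrow> indep_free A n W'"
  unfolding indep_free_def using finite_subset order_trans by metis

lemma is_emb_mono: "is_emb E V A W g \<Longrightarrow> W \<subseteq> W' \<Longrightarrow> is_emb E V A W' g"
  unfolding is_emb_def by blast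

lemma is_emb_insert:
  assumes "is_emb E V A W g" "sgraph E" "sgraph A" "x \<notin> V" "x0 \<in> W" "x0 \<notin> g ` V"
    and "\<And>u. u \<in> V \<Longrightarrow> E x u \<Longrightarrow> A (g u) x0"
  shows "is_emb E (insert x V) A W (g(x := x0))"
proof -
  interpret E: sgraph E by fact
  interpret A: sgraph A by fact
  have "inj_on (g(x := x0)) (insert x V)"
    using assms(1,4,6) by (auto simp: is_emb_def inj_on_def)
  moreover have "(g(x := x0)) ` insert x V \<subseteq> W"
    using assms(1,5) by (auto simp: is_emb_def)
  moreover have "A ((g(x := x0)) u) ((g(x := x0)) v)"
    if "u \<in> insert x V" "v \<in> insert x V" "E u v" for u v
  proof (cases "u = x")
    case True
    then have "v \<in> V" "v \<noteq> x" using that E.irrefl assms(4) by auto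
    then show ?thesis using True that assms(7)[of v] A.sym by simp
  next
    case False
    then show ?thesis using that assms(1) assms(7)[of u] E.sym by (auto simp: is_emb_def)
  qed
  ultimately show ?thesis by (simp add: is_emb_def)
qed

section \<open>Independent sets in sparse graphs and random neighbourhoods\<close>

lemma sum_card_swap:
  assumes "finite X" "finite Y"
  shows "(\<Sum>x\<in>X. card {y \<in> Y. P x y}) = (\<Sum>y\<in>Y. card {x \<in> X. P x y})"
  using sum_multicount_gen[OF assms, where R = P and k = "\<lambda>y. card {x \<in> X. P x y}"] by simp

text \<open>Greedy choice: take a vertex with at most \<open>D\<close> neighbours in the current set
  and discard it with them, so each chosen vertex uses up at most \<open>D + 1\<close>.
  \<open>B\<close> may be asymmetric, so that the lemma serves graphs and digraphs alike.\<close>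

lemma degenerate_indep:
  assumes "finite X"
    and "\<And>Y. Y \<subseteq> X \<Longrightarrow> Y \<noteq> {} \<Longrightarrow> \<exists>y\<in>Y. card {z \<in> Y. z \<noteq> y \<and> (B y z \<or> B z y)} \<le> D"
  shows "\<exists>I\<subseteq>X. (\<forall>u\<in>I. \<forall>v\<in>I. u \<noteq> v \<longrightarrow> \<not> B u v) \<and> card X \<le> (D + 1) * card I"
  using assms
proof (induction X rule: finite_psubset_induct)
  case (psubset X)
  show ?case
  proof (cases "X = {}")
    case True
    then show ?thesis by (intro exI[of _ "{}"]) auto
  next
    case False
    from psubset.prems[OF subset_refl False] obtain y where
      y: "y \<in> X" "card {z \<in> X. z \<noteq> y \<and> (B y z \<or> B z y)} \<le> D" by blast
    let ?N = "{z \<in> X. z \<noteq> y \<and> (B y z \<or> B z y)}"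
    let ?X = "X - insert y ?N"
    have "?X \<subset> X" using y by auto
    have "\<exists>I\<subseteq>?X. (\<forall>u\<in>I. \<forall>v\<in>I. u \<noteq> v \<longrightarrow> \<not> B u v) \<and> card ?X \<le> (D + 1) * card I"
      by (rule psubset.IH[OF \<open>?X \<subset> X\<close> psubset.prems]) auto
    then obtain I where
      I: "I \<subseteq> ?X" "\<forall>u\<in>I. \<forall>v\<in>I. u \<noteq> v \<longrightarrow> \<not> B u v" "card ?X \<le> (D + 1) * card I" by auto
    have cN: "card (insert y ?N) \<le> D + 1"
      using y psubset.hyps by (simp add: card_insert_if)
    have cX: "card X = card ?X + card (insert y ?N)"
    proof -
      have "X = ?X \<union> insert y ?N" "?X \<inter> insert y ?N = {}" using y by auto
      then show ?thesis using psubset.hyps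
        by (metis (no_types, lifting) card_Un_disjoint finite_Un)
    qed
    have "finite I" using I psubset.hyps by (meson finite_Diff finite_subset)
    moreover have "y \<notin> I" using I(1) by blast
    ultimately have cI: "card (insert y I) = card I + 1" by simp
    have "card X \<le> (D + 1) * card (insert y I)"
      using I(3) cN cX unfolding cI by (simp only: add_mult_distrib2) simp
    then show ?thesis using I y by (intro exI[of _ "insert y I"]) auto
  qed
qed

text \<open>Any subset \<open>Y\<close> spans at most \<open>t * card Y\<close> arcs, so some vertex
  of \<open>Y\<close> has in-degree plus out-degree at most \<open>2 * t\<close>; the digraph is
  \<open>2 * t\<close>-degenerate.\<close>

lemma out_degree_indep:
  assumes "finite X" "\<And>y. y \<in> X \<Longrightarrow> finite (Z y) \<and> card (Z y) \<le> t"
  shows "\<exists>I\<subseteq>X. (\<forall>u\<in>I. \<forall>v\<in>I. u \<noteq> v \<longrightarrow> v \<notin> Z u) \<and> card X \<le> (2 * t + 1) * card I"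
proof (rule degenerate_indep[OF assms(1)])
  fix Y assume Y: "Y \<subseteq> X" "Y \<noteq> {}"
  then have fin: "finite Y" using assms(1) finite_subset by blast
  show "\<exists>y\<in>Y. card {z \<in> Y. z \<noteq> y \<and> (z \<in> Z y \<or> y \<in> Z z)} \<le> 2 * t"
  proof (rule ccontr)
    assume "\<not> ?thesis"
    then have "\<forall>y\<in>Y. \<not> card {z \<in> Y. z \<noteq> y \<and> (z \<in> Z y \<or> y \<in> Z z)} \<le> 2 * t"
      by blast
    then have *: "2 * t + 1 \<le> card {z \<in> Y. z \<noteq> y \<and> (z \<in> Z y \<or> y \<in> Z z)}" if "y \<in> Y" for y
      using that by (simp add: not_le Suc_le_eq)
    have le: "card {z \<in> Y. z \<in> Z y} \<le> t" if "y \<in> Y" for y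
    proof -
      have "finite (Z y)" "card (Z y) \<le> t" using assms(2) that Y by auto
      moreover have "card {z \<in> Y. z \<in> Z y} \<le> card (Z y)"
        using \<open>finite (Z y)\<close> by (intro card_mono) auto
      ultimately show ?thesis by simp
    qed
    have "card Y * (2 * t + 1) \<le> (\<Sum>y\<in>Y. card {z \<in> Y. z \<noteq> y \<and> (z \<in> Z y \<or> y \<in> Z z)})"
      using sum_bounded_below[OF *, of Y] by simp
    also have "\<dots> \<le> (\<Sum>y\<in>Y. card {z \<in> Y. z \<in> Z y} + card {z \<in> Y. y \<in> Z z})"
    proof (rule sum_mono)
      fix y
      have "card {z \<in> Y. z \<noteq> y \<and> (z \<in> Z y \<or> y \<in> Z z)}
          \<le> card ({z \<in> Y. z \<in> Z y} \<union> {z \<in> Y. y \<in> Z z})"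
        using fin by (intro card_mono) auto
      then show "card {z \<in> Y. z \<noteq> y \<and> (z \<in> Z y \<or> y \<in> Z z)}
          \<le> card {z \<in> Y. z \<in> Z y} + card {z \<in> Y. y \<in> Z z}"
        using card_Un_le le_trans by blast
    qed
    also have "\<dots> = 2 * (\<Sum>y\<in>Y. card {z \<in> Y. z \<in> Z y})"
      using sum_card_swap[OF fin fin, of "\<lambda>y z. z \<in> Z y"] by (simp add: sum.distrib)
    also have "\<dots> \<le> 2 * (card Y * t)"
      using sum_bounded_above[of Y, OF le] by simp
    finally have "card Y = 0" by (simp add: algebra_simps)
    then show False using Y fin by simp
  qed
qed

text \<open>The vertices of degree below \<open>D\<close> induce a graph of maximum degree below
  \<open>D\<close>, so a \<open>D\<close>-th of them is independent, and that is fewer than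
  \<open>n\<close>. This is the only way in which the absence of independent \<open>n\<close>-sets
  yields degrees.\<close>

lemma low_degree:
  assumes "sgraph A" "indep_free A n W" "n \<ge> 1" "D \<ge> 1"
  shows "card {w \<in> W. card (nbh A W w) < D} < D * n"
proof -
  interpret sgraph A by fact
  let ?X = "{w \<in> W. card (nbh A W w) < D}"
  have fin: "finite W" using assms(2) by (simp add: indep_free_def)
  have "\<exists>I\<subseteq>?X. (\<forall>u\<in>I. \<forall>v\<in>I. u \<noteq> v \<longrightarrow> \<not> A u v) \<and> card ?X \<le> (D - 1 + 1) * card I"
  proof (rule degenerate_indep)
    fix Y assume Y: "Y \<subseteq> ?X" "Y \<noteq> {}"
    then obtain y where y: "y \<in> Y" by blast
    have "card {z \<in> Y. z \<noteq> y \<and> (A y z \<or> A z y)} \<le> card (nbh A W y)"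
      using Y fin sym by (intro card_mono finite_nbh) (auto simp: nbh_def)
    then show "\<exists>y\<in>Y. card {z \<in> Y. z \<noteq> y \<and> (A y z \<or> A z y)} \<le> D - 1"
      using y Y by fastforce
  qed (use fin in auto)
  then obtain I where I: "I \<subseteq> ?X" "\<forall>u\<in>I. \<forall>v\<in>I. u \<noteq> v \<longrightarrow> \<not> A u v" "card ?X \<le> D * card I"
    using assms(4) by auto
  have "card I < n"
  proof (rule ccontr)
    assume "\<not> card I < n"
    then obtain S where "S \<subseteq> I" "card S = n" by (meson not_less obtain_subset_with_card_n)
    moreover from this obtain u v where "u \<in> S" "v \<in> S" "A u v"
      using assms(2) I(1) unfolding indep_free_def by (metis (lifting) mem_Collect_eq subset_iff)
    ultimately show False using I(2) irrefl by (metis subsetD)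
  qed
  then have "D * card I < D * n" using assms(4) by simp
  then show ?thesis using I(3) by (rule order.strict_trans1[rotated])
qed

lemma card_pairs: "finite W \<Longrightarrow> card {(a, b). a \<in> W \<and> b \<in> W \<and> P a b} = (\<Sum>a\<in>W. card {b \<in> W. P a b})"
proof -
  assume "finite W"
  moreover have "{(a, b). a \<in> W \<and> b \<in> W \<and> P a b} = Sigma W (\<lambda>a. {b \<in> W. P a b})" by auto
  ultimately show ?thesis by simp
qed

text \<open>Dependent random choice, with a single vertex \<open>v\<close> chosen: a pair with few common neighbours
  rarely survives in a random neighbourhood.\<close>

lemma neighbourhood_few_pairs:
  assumes "sgraph A" "indep_free A n W" "n \<ge> 1" "card W = 2 * D * n" "D \<ge> 1"
    and P: "\<And>a b. a \<in> W \<Longrightarrow> b \<in> W \<Longrightarrow> P a b \<Longrightarrow> card {u \<in> W. A a u \<and> A b u} \<le> h"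
  shows "\<exists>v\<in>W. D \<le> card (nbh A W v) \<and>
    card {(a, b). a \<in> nbh A W v \<and> b \<in> nbh A W v \<and> P a b} * card W
      \<le> 2 * h * card {(a, b). a \<in> W \<and> b \<in> W \<and> P a b}"
proof (rule ccontr)
  interpret sgraph A by fact
  assume neg: "\<not> ?thesis"
  let ?M = "{(a, b). a \<in> W \<and> b \<in> W \<and> P a b}"
  let ?bad = "\<lambda>v. {(a, b). a \<in> nbh A W v \<and> b \<in> nbh A W v \<and> P a b}"
  let ?Y = "{w \<in> W. D \<le> card (nbh A W w)}"
  have fin: "finite W" using assms(2) by (simp add: indep_free_def)
  have finM: "finite ?M" by (rule finite_subset[of _ "W \<times> W"]) (use fin in auto)
  have "?Y = W - {w \<in> W. card (nbh A W w) < D}" by auto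
  then have "card ?Y = card W - card {w \<in> W. card (nbh A W w) < D}"
    using fin by (simp add: card_Diff_subset)
  \<comment> \<open>Since \<open>card W = 2 * D * n\<close>, fewer than half of the vertices have
    degree below \<open>D\<close>; averaging over the others loses only a factor 2.\<close>
  then have Y: "card W < 2 * card ?Y"
    using low_degree[OF assms(1-3,5)] assms(4) by (simp add: mult.assoc)
  have b: "2 * h * card ?M + 1 \<le> card (?bad v) * card W" if "v \<in> ?Y" for v
  proof -
    have "\<not> card (?bad v) * card W \<le> 2 * h * card ?M" using neg that by blast
    then show ?thesis by simp
  qed
  have bad: "?bad v = {m \<in> ?M. A v (fst m) \<and> A v (snd m)}" for v
    by (auto simp: nbh_def)
  have "card ?Y * (2 * h * card ?M + 1) \<le> (\<Sum>v\<in>?Y. card (?bad v) * card W)"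
    using sum_bounded_below[of ?Y, OF b] by simp
  also have "\<dots> \<le> (\<Sum>v\<in>W. card (?bad v)) * card W"
    unfolding sum_distrib_right by (rule sum_mono2) (use fin in auto)
  also have "(\<Sum>v\<in>W. card (?bad v)) = (\<Sum>m\<in>?M. card {v \<in> W. A v (fst m) \<and> A v (snd m)})"
    unfolding bad by (rule sum_card_swap[OF fin finM])
  also have "\<dots> \<le> card ?M * h"
  proof -
    have "card {v \<in> W. A v (fst m) \<and> A v (snd m)} \<le> h" if "m \<in> ?M" for m
    proof -
      have "{v \<in> W. A v (fst m) \<and> A v (snd m)} = {v \<in> W. A (fst m) v \<and> A (snd m) v}"
        using sym by blast
      moreover have "fst m \<in> W" "snd m \<in> W" "P (fst m) (snd m)" using that by auto
      ultimately show ?thesis using P by simp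
    qed
    from sum_bounded_above[of ?M, OF this] show ?thesis by simp
  qed
  finally have 1: "card ?Y * (2 * h * card ?M + 1) \<le> card ?M * h * card W" by simp
  have "card ?M * h * card W \<le> card ?M * h * (2 * card ?Y)" using Y by (intro mult_left_mono) auto
  also have "\<dots> < card ?Y * (2 * h * card ?M + 1)" using Y by (simp add: algebra_simps)
  finally show False using 1 by simp
qed

text \<open>Because \<open>I\<close> is independent, the candidates for \<open>w\<close> depend only
  on \<open>g\<close>, not on the vertices of \<open>I\<close> already placed. Fewer than
  \<open>card V\<close> host vertices are occupied at any time, so a free candidate always
  remains.\<close>

lemma is_emb_extend:
  assumes "sgraph E" "sgraph A" "finite V" "finite W" "I \<subseteq> V"
    and I: "\<And>w u. w \<in> I \<Longrightarrow> u \<in> I \<Longrightarrow> \<not> E w u"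
    and g: "is_emb E (V - I) A W g"
    and cand: "\<And>w. w \<in> I \<Longrightarrow> card V \<le> card {y \<in> W. \<forall>u\<in>V - I. E w u \<longrightarrow> A (g u) y}"
  shows "\<exists>f. is_emb E V A W f"
proof -
  have "\<exists>f. is_emb E ((V - I) \<union> J) A W f \<and> (\<forall>u\<in>V - I. f u = g u)" if "finite J" "J \<subseteq> I" for J
    using that
  proof (induction J rule: finite_induct)
    case empty
    then show ?case using g by auto
  next
    case (insert w J)
    then obtain f where f: "is_emb E ((V - I) \<union> J) A W f" "\<forall>u\<in>V - I. f u = g u" by auto
    let ?U = "(V - I) \<union> J"
    let ?Y = "{y \<in> W. \<forall>u\<in>V - I. E w u \<longrightarrow> A (g u) y}"
    have w: "w \<notin> ?U" "w \<in> I" using insert by auto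
    have "?U \<subset> V" using w insert.prems assms(5) by auto
    then have "card ?U < card V" using assms(3) by (rule psubset_card_mono[rotated])
    then have "card (f ` ?U) < card ?Y"
      using cand[OF w(2)] card_image_le[of ?U f] assms(3) insert.hyps by fastforce
    then have "\<not> ?Y \<subseteq> f ` ?U"
      using card_mono[of "f ` ?U" ?Y] assms(3) insert.hyps by fastforce
    then obtain y where y: "y \<in> ?Y" "y \<notin> f ` ?U" by blast
    have "is_emb E (insert w ?U) A W (f(w := y))"
      using y f(2) insert.prems I w
      by (intro is_emb_insert[OF f(1) assms(1,2)]) auto
    then show ?case using f(2) w
      by (intro exI[of _ "f(w := y)"]) (simp del: fun_upd_apply, simp)
  qed
  from this[of I] show ?thesis using assms(3,5) by (auto simp: finite_subset Un_absorb1 Un_commute)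
qed

section \<open>Boundedness under adding a leaf or an apex\<close>

lemma ramsey_bounded_empty: "ramsey_bounded E k {}"
  by (auto simp: ramsey_bounded_def is_emb_def)

lemma ramsey_boundedE:
  assumes "ramsey_bounded E k V"
  obtains C where "\<And>n A W. n \<ge> 1 \<Longrightarrow> sgraph A \<Longrightarrow> indep_free A n W \<Longrightarrow> C * n ^ k \<le> card W
    \<Longrightarrow> \<exists>g. is_emb E V (A :: nat \<Rightarrow> nat \<Rightarrow> bool) W g"
  using assms unfolding ramsey_bounded_def by metis

lemma self_le_pow: "(n::nat) \<ge> 1 \<Longrightarrow> k \<ge> 1 \<Longrightarrow> n \<le> n ^ k"
  by (metis power_increasing power_one_right)

text \<open>Host vertices of degree at most \<open>card V\<close> number less than
  \<open>(card V + 1) * n\<close>, which a constant times \<open>n ^ k\<close> absorbs as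
  \<open>k \<ge> 1\<close>. Once they are discarded, the image of the neighbour of \<open>x\<close>
  has a neighbour outside the copy of \<open>V\<close>.\<close>

lemma ramsey_bounded_leaf:
  assumes "sgraph E" "ramsey_bounded E k V" "k \<ge> 1" "finite V"
    and leaf: "\<And>u u'. u \<in> V \<Longrightarrow> u' \<in> V \<Longrightarrow> E x u \<Longrightarrow> E x u' \<Longrightarrow> u = u'"
  shows "ramsey_bounded E k (insert x V)"
proof (cases "x \<in> V")
  case True
  then show ?thesis using assms(2) by (simp add: insert_absorb)
next
  case False
  obtain C where C: "\<And>n A W. n \<ge> 1 \<Longrightarrow> sgraph A \<Longrightarrow> indep_free A n W \<Longrightarrow> C * n ^ k \<le> card W
    \<Longrightarrow> \<exists>g. is_emb E V (A :: nat \<Rightarrow> nat \<Rightarrow> bool) W g"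
    using ramsey_boundedE[OF assms(2)] by metis
  let ?D = "card V + 1"
  have "\<exists>g. is_emb E (insert x V) A W g"
    if n: "n \<ge> 1" and A: "sgraph A" "indep_free A n W" and W: "(C + ?D) * n ^ k \<le> card W"
    for n and A :: "nat \<Rightarrow> nat \<Rightarrow> bool" and W
  proof -
    interpret A: sgraph A by fact
    have fin: "finite W" using A by (simp add: indep_free_def)
    let ?X = "{w \<in> W. card (nbh A W w) < ?D}"
    have "card ?X < ?D * n" by (rule low_degree) (use A n in auto)
    also have "\<dots> \<le> ?D * n ^ k" using self_le_pow[OF n assms(3)] by (intro mult_left_mono) auto
    finally have "C * n ^ k \<le> card (W - ?X)"
      using W fin by (subst card_Diff_subset) (auto simp: add_mult_distrib)
    then obtain g where g: "is_emb E V A (W - ?X) g"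
      using C[OF n A(1) indep_free_subset[OF A(2)], of "W - ?X"] by auto
    have card_g: "card (g ` V) \<le> card V" using assms(4) card_image_le by blast
    have "\<exists>x0\<in>W. x0 \<notin> g ` V \<and> (\<forall>u\<in>V. E x u \<longrightarrow> A (g u) x0)"
    proof (cases "\<exists>u\<in>V. E x u")
      case True
      then obtain u where u: "u \<in> V" "E x u" by blast
      have "g u \<in> W - ?X" using g u by (auto simp: is_emb_def)
      then have "card V < card (nbh A W (g u))" by auto
      then have "\<not> nbh A W (g u) \<subseteq> g ` V"
        using card_g assms(4) by (metis card_mono finite_imageI le_trans not_less)
      then obtain x0 where "x0 \<in> nbh A W (g u)" "x0 \<notin> g ` V" by blast
      then show ?thesis using leaf u by (auto simp: nbh_def)
    next
      case False
      have "1 \<le> n ^ k" using n by simp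
      then have "?D * 1 \<le> ?D * n ^ k" by (rule mult_le_mono2)
      also have "\<dots> \<le> card W" using W by (simp add: algebra_simps)
      finally have "card V < card W" by simp
      then have "\<not> W \<subseteq> g ` V"
        using card_g assms(4) by (metis card_mono finite_imageI le_trans not_less)
      then show ?thesis using False by auto
    qed
    then obtain x0 where "x0 \<in> W" "x0 \<notin> g ` V" "\<forall>u\<in>V. E x u \<longrightarrow> A (g u) x0" by blast
    then have "is_emb E (insert x V) A W (g(x := x0))"
      using False by (intro is_emb_insert[OF is_emb_mono[OF g] assms(1) A(1)]) auto
    then show ?thesis by blast
  qed
  then show ?thesis unfolding ramsey_bounded_def by blast
qed

text \<open>Embedding the rest inside the neighbourhood of \<open>v0\<close> makes \<open>v0\<close>
  adjacent to all of it, whatever the degree of \<open>v\<close>. The summand 1 in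
  \<open>C + 1\<close> keeps the degree threshold positive, as \<open>low_degree\<close>
  requires.\<close>

lemma ramsey_bounded_apex:
  assumes "sgraph E" "ramsey_bounded E k (V - {v})" "v \<in> V"
  shows "ramsey_bounded E (Suc k) V"
proof -
  obtain C where C: "\<And>n A W. n \<ge> 1 \<Longrightarrow> sgraph A \<Longrightarrow> indep_free A n W \<Longrightarrow> C * n ^ k \<le> card W
    \<Longrightarrow> \<exists>g. is_emb E (V - {v}) (A :: nat \<Rightarrow> nat \<Rightarrow> bool) W g"
    using ramsey_boundedE[OF assms(2)] by metis
  have "\<exists>g. is_emb E V A W g"
    if n: "n \<ge> 1" and A: "sgraph A" "indep_free A n W" and W: "(C + 1) * n ^ Suc k \<le> card W"
    for n and A :: "nat \<Rightarrow> nat \<Rightarrow> bool" and W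
  proof -
    interpret A: sgraph A by fact
    let ?D = "(C + 1) * n ^ k"
    have "card {w \<in> W. card (nbh A W w) < ?D} < ?D * n"
      by (rule low_degree[OF A n]) (use n in \<open>simp add: Suc_le_eq\<close>)
    then have "{w \<in> W. card (nbh A W w) < ?D} \<noteq> W" using W by (auto simp: algebra_simps)
    then obtain v0 where v0: "v0 \<in> W" "?D \<le> card (nbh A W v0)" by force
    then obtain g where g: "is_emb E (V - {v}) A (nbh A W v0) g"
      using C[OF n A(1) indep_free_subset[OF A(2) nbh_subset[of A W v0]]] by auto
    have "is_emb E (insert v (V - {v})) A W (g(v := v0))"
      using g v0 A.sym A.irrefl
      by (intro is_emb_insert[OF is_emb_mono[OF g nbh_subset] assms(1) A(1)])
        (auto simp: is_emb_def nbh_def)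
    then show ?thesis using assms(3) by (auto simp: insert_absorb)
  qed
  then show ?thesis unfolding ramsey_bounded_def by blast
qed

section \<open>Gluing and attaching vertices of small degree\<close>

text \<open>A root is bad if few vertices \<open>Z\<close> meet all copies of \<open>S\<close> rooted there. Bad roots are few, since
  a large set of them contains an independent set of the out-degree bounded digraph given by the \<open>Z\<close>.\<close>

lemma ramsey_bounded_glue:
  assumes "sgraph E" "finite V" "S \<union> T = V" "S \<inter> T = {r}"
    and no_edge: "\<And>s t. s \<in> S - {r} \<Longrightarrow> t \<in> T - {r} \<Longrightarrow> \<not> E s t"
    and "ramsey_bounded E k S" "ramsey_bounded E k T"
  shows "ramsey_bounded E k V"
proof -
  interpret E: sgraph E by fact
  obtain C where C: "\<And>n A W. n \<ge> 1 \<Longrightarrow> sgraph A \<Longrightarrow> indep_free A n W \<Longrightarrow> C * n ^ k \<le> card W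
    \<Longrightarrow> \<exists>g. is_emb E S (A :: nat \<Rightarrow> nat \<Rightarrow> bool) W g"
    using ramsey_boundedE[OF assms(6)] by metis
  obtain C' where C': "\<And>n A W. n \<ge> 1 \<Longrightarrow> sgraph A \<Longrightarrow> indep_free A n W \<Longrightarrow> C' * n ^ k \<le> card W
    \<Longrightarrow> \<exists>g. is_emb E T (A :: nat \<Rightarrow> nat \<Rightarrow> bool) W g"
    using ramsey_boundedE[OF assms(7)] by metis
  define t where "t = card T"
  have finT: "finite T" using assms(2,3) by auto
  have rS: "r \<in> S" "r \<in> T" using assms(4) by auto
  have "\<exists>g. is_emb E V A W g"
    if n: "n \<ge> 1" and A: "sgraph A" "indep_free A n W"
      and W: "((2 * t + 1) * C + C') * n ^ k \<le> card W"
    for n and A :: "nat \<Rightarrow> nat \<Rightarrow> bool" and W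
  proof -
    interpret A: sgraph A by fact
    have fin: "finite W" using A by (simp add: indep_free_def)
    \<comment> \<open>\<open>t = card T\<close> bounds the number of vertices that a copy of
      \<open>T\<close> occupies besides its root. The clause \<open>w \<notin> Z\<close> prevents
      the root itself from being the vertex that is hit.\<close>
    define bad where "bad w Z \<longleftrightarrow> finite Z \<and> card Z \<le> t \<and> w \<notin> Z \<and>
      (\<forall>f. is_emb E S A W f \<longrightarrow> f r = w \<longrightarrow> f ` S \<inter> Z \<noteq> {})" for w Z
    let ?B = "{w \<in> W. \<exists>Z. bad w Z}"
    have "\<forall>w\<in>?B. \<exists>Z. bad w Z" by simp
    from bchoice[OF this] obtain Z where Z: "\<And>w. w \<in> ?B \<Longrightarrow> bad w (Z w)" by blast
    have "\<exists>I\<subseteq>?B. (\<forall>u\<in>I. \<forall>v\<in>I. u \<noteq> v \<longrightarrow> v \<notin> Z u) \<and> card ?B \<le> (2 * t + 1) * card I"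
    proof (rule out_degree_indep)
      show "finite ?B" using fin by simp
      show "finite (Z w) \<and> card (Z w) \<le> t" if "w \<in> ?B" for w using Z[OF that] by (simp add: bad_def)
    qed
    then obtain I where
      I: "I \<subseteq> ?B" "\<forall>u\<in>I. \<forall>v\<in>I. u \<noteq> v \<longrightarrow> v \<notin> Z u" "card ?B \<le> (2 * t + 1) * card I"
      by blast
    \<comment> \<open>Otherwise \<open>S\<close> embeds into \<open>I\<close>. Its image has to meet
      \<open>Z (f r)\<close>, and does so in a vertex of \<open>I\<close> other than
      \<open>f r\<close>, against the independence of \<open>I\<close>.\<close>
    have "card I < C * n ^ k"
    proof (rule ccontr)
      assume "\<not> card I < C * n ^ k"
      moreover have "indep_free A n I" by (rule indep_free_subset[OF A(2)]) (use I in auto)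
      ultimately obtain f where f: "is_emb E S A I f" using C[OF n A(1), of I] by (meson not_less)
      then have fr: "f r \<in> I" using rS by (auto simp: is_emb_def)
      have fW: "is_emb E S A W f" by (rule is_emb_mono[OF f]) (use I(1) in auto)
      have "f r \<in> ?B" using fr I(1) by blast
      from Z[OF this] have "f r \<notin> Z (f r)" and hit: "\<And>f'. is_emb E S A W f' \<Longrightarrow> f' r = f r \<Longrightarrow> f' ` S \<inter> Z (f r) \<noteq> {}"
        unfolding bad_def by blast+
      have "f ` S \<inter> Z (f r) \<noteq> {}" using hit[OF fW] by simp
      then obtain z where z: "z \<in> Z (f r)" "z \<in> I" using f by (auto simp: is_emb_def)
      moreover have "z \<noteq> f r" using z(1) \<open>f r \<notin> Z (f r)\<close> by blast
      ultimately show False using I(2)[rule_format, of "f r" z] fr by auto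
    qed
    then have "card ?B \<le> (2 * t + 1) * (C * n ^ k)"
      using I(3) by (meson le_trans less_imp_le_nat mult_le_mono2)
    then have "C' * n ^ k \<le> card (W - ?B)"
      using W fin by (subst card_Diff_subset) (auto simp: add_mult_distrib mult.assoc)
    moreover have "indep_free A n (W - ?B)" by (rule indep_free_subset[OF A(2)]) auto
    ultimately obtain g where g: "is_emb E T A (W - ?B) g" using C'[OF n A(1)] by blast
    \<comment> \<open>The root \<open>g r\<close> is not bad, so this particular set cannot meet all
      copies of \<open>S\<close> rooted there: some copy of \<open>S\<close> meets the copy of
      \<open>T\<close> only in the root.\<close>
    let ?Z = "g ` T - {g r}"
    have "card ?Z \<le> card (g ` T)" using finT by (intro card_mono) auto
    also have "\<dots> \<le> t" unfolding t_def using finT by (rule card_image_le)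
    finally have "card ?Z \<le> t" .
    moreover have "g r \<in> W - ?B" using g rS by (auto simp: is_emb_def)
    moreover have "finite ?Z" using finT by simp
    moreover have "\<not> bad (g r) ?Z" using \<open>g r \<in> W - ?B\<close> by blast
    ultimately obtain f where f: "is_emb E S A W f" "f r = g r" "f ` S \<inter> ?Z = {}"
      unfolding bad_def by blast
    let ?f = "\<lambda>u. if u \<in> S then f u else g u"
    have eq: "?f u = g u" if "u \<in> T" for u using that assms(4) f(2) by auto
    have V: "u \<in> S \<or> (u \<in> T \<and> u \<notin> S \<and> u \<noteq> r)" if "u \<in> V" for u using that assms(3,4) by auto
    have fg: "f u \<noteq> g v" if "u \<in> S" "v \<in> T" "v \<noteq> r" for u v
    proof
      assume "f u = g v"
      moreover have "g v \<noteq> g r" using g that rS by (auto simp: is_emb_def inj_on_def)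
      ultimately show False using f(3) that by auto
    qed
    have "inj_on ?f V"
    proof (rule inj_onI)
      fix u v assume uv: "u \<in> V" "v \<in> V" "?f u = ?f v"
      have inj: "inj_on f S" "inj_on g T" using f(1) g by (auto simp: is_emb_def)
      consider "u \<in> S" "v \<in> S" | "u \<in> S" "v \<in> T" "v \<notin> S" "v \<noteq> r" | "u \<in> T" "u \<notin> S" "u \<noteq> r" "v \<in> S"
        | "u \<in> T" "u \<notin> S" "v \<in> T" "v \<notin> S"
        using V[OF uv(1)] V[OF uv(2)] by blast
      then show "u = v"
      proof cases
        case 1
        then show ?thesis using uv(3) inj_onD[OF inj(1)] by simp
      next
        case 2
        then show ?thesis using uv(3) fg[of u v] by simp
      next
        case 3
        then show ?thesis using uv(3) fg[of v u] by simp
      next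
        case 4
        then show ?thesis using uv(3) inj_onD[OF inj(2)] by simp
      qed
    qed
    moreover have "?f ` V \<subseteq> W" using f(1) g assms(3) by (auto simp: is_emb_def)
    moreover have "A (?f u) (?f v)" if uv: "u \<in> V" "v \<in> V" "E u v" for u v
    proof (cases "u \<in> S \<and> v \<in> S")
      case True
      then show ?thesis using f(1) uv by (auto simp: is_emb_def)
    next
      case False
      then have "u \<in> T \<and> v \<in> T"
        using V[OF uv(1)] V[OF uv(2)] no_edge[of u v] no_edge[of v u] E.sym[OF uv(3)] uv(3) rS by auto
      then show ?thesis using g uv eq by (simp add: is_emb_def)
    qed
    ultimately have "is_emb E V A W ?f" unfolding is_emb_def by blast
    then show ?thesis by blast
  qed
  then show ?thesis unfolding ramsey_bounded_def by blast
qed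

text \<open>The host vertex \<open>v0\<close> plays \<open>v\<close>, a vertex \<open>x0\<close> of its neighbourhood plays \<open>x\<close>, and the vertices
  of \<open>I\<close> are placed last, greedily, among common neighbours.\<close>

lemma attach_common_neighbours:
  assumes "sgraph E" "sgraph A" "finite V" "finite W" "v \<in> V" "x \<in> V" "v \<noteq> x" "I \<subseteq> V - {v, x}"
    and g: "is_emb E (V - I - {v, x}) A U g" "U \<subseteq> nbh A W v0" "v0 \<in> W"
    and x0: "x0 \<in> U" "x0 \<notin> g ` (V - I - {v, x})"
      "\<And>u. u \<in> V - I - {v, x} \<Longrightarrow> E x u \<Longrightarrow> A (g u) x0"
    and I: "\<And>w. w \<in> I \<Longrightarrow> y w \<in> V - I - {v, x} \<and> (\<forall>u\<in>V. E w u \<longrightarrow> u = x \<or> u = y w) \<and>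
        card V \<le> card {u \<in> W. A x0 u \<and> A (g (y w)) u}"
  shows "\<exists>f. is_emb E V A W f"
proof -
  interpret A: sgraph A by fact
  let ?V = "V - I - {v, x}"
  have UW: "U \<subseteq> W" using g(2) nbh_subset[of A W v0] by (rule order_trans)
  let ?g1 = "g(x := x0)" and ?g2 = "g(x := x0, v := v0)"
  have g1: "is_emb E (insert x ?V) A U ?g1"
    by (rule is_emb_insert) (use g x0 assms(1,2) in auto)
  have g2: "is_emb E (insert v (insert x ?V)) A W ?g2"
  proof (rule is_emb_insert)
    show "is_emb E (insert x ?V) A W ?g1" using g1 UW by (rule is_emb_mono)
    show "v \<notin> insert x ?V" using assms by auto
    have gU: "?g1 u \<in> U" if "u \<in> insert x ?V" for u
      using g1 that unfolding is_emb_def by blast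
    then show "v0 \<notin> ?g1 ` insert x ?V"
      using g(2) A.irrefl by (auto simp: nbh_def simp del: fun_upd_apply)
    show "A (?g1 u) v0" if "u \<in> insert x ?V" for u
      using gU[OF that] g(2) A.sym unfolding nbh_def by blast
  qed (use assms in auto)
  have VI: "insert v (insert x ?V) = V - I" using assms(5,6,8) by auto
  show ?thesis
  proof (rule is_emb_extend[OF assms(1-4) _ _ g2[unfolded VI]])
    show "I \<subseteq> V" using assms(8) by auto
    show "\<not> E w u" if "w \<in> I" "u \<in> I" for w u
      using I[OF that(1)] that assms(8) by blast
    fix w assume w: "w \<in> I"
    have "{u \<in> W. A x0 u \<and> A (g (y w)) u} \<subseteq> {z \<in> W. \<forall>u\<in>V - I. E w u \<longrightarrow> A (?g2 u) z}"
      using I[OF w] assms(7) by auto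
    then have "card {u \<in> W. A x0 u \<and> A (g (y w)) u} \<le> card {z \<in> W. \<forall>u\<in>V - I. E w u \<longrightarrow> A (?g2 u) z}"
      using assms(4) by (intro card_mono) auto
    then show "card V \<le> card {z \<in> W. \<forall>u\<in>V - I. E w u \<longrightarrow> A (?g2 u) z}" using I[OF w] by linarith
  qed
qed

text \<open>The trivial count of \<open>card W ^ 2\<close> pairs already suffices: at most
  \<open>2 * h * card W = 4 * h * n * D\<close> bad pairs survive in the neighbourhood, hence on
  average at most \<open>4 * h * n\<close> per vertex of it.\<close>

lemma neighbourhood_few_bad_pairs:
  assumes "sgraph A" "indep_free A n W" "n \<ge> 1" "card W = 2 * D * n" "D \<ge> 1"
  shows "\<exists>v\<in>W. D \<le> card (nbh A W v) \<and>
    (\<Sum>a\<in>nbh A W v. card {b \<in> nbh A W v. card {u \<in> W. A a u \<and> A b u} < h}) \<le> 4 * h * n * card (nbh A W v)"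
proof -
  let ?P = "\<lambda>a b. card {u \<in> W. A a u \<and> A b u} < h"
  have fin: "finite W" using assms(2) by (simp add: indep_free_def)
  obtain v where v: "v \<in> W" "D \<le> card (nbh A W v)"
    and b: "card {(a, b). a \<in> nbh A W v \<and> b \<in> nbh A W v \<and> ?P a b} * card W
      \<le> 2 * h * card {(a, b). a \<in> W \<and> b \<in> W \<and> ?P a b}"
    using neighbourhood_few_pairs[OF assms, of ?P h] by auto
  have "card {(a, b). a \<in> W \<and> b \<in> W \<and> ?P a b} \<le> card (W \<times> W)"
    using fin by (intro card_mono) auto
  then have "2 * h * card {(a, b). a \<in> W \<and> b \<in> W \<and> ?P a b} \<le> (2 * h * card W) * card W"
    by (simp add: card_cartesian_product)
  with b have "card {(a, b). a \<in> nbh A W v \<and> b \<in> nbh A W v \<and> ?P a b} * card W \<le> (2 * h * card W) * card W"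
    by linarith
  moreover have "card W > 0" using assms by simp
  ultimately have "card {(a, b). a \<in> nbh A W v \<and> b \<in> nbh A W v \<and> ?P a b} \<le> 2 * h * card W" by simp
  also have "\<dots> = 4 * h * n * D" using assms(4) by simp
  also have "\<dots> \<le> 4 * h * n * card (nbh A W v)" using v(2) by (rule mult_le_mono2)
  finally show ?thesis
    using v by (subst (asm) card_pairs[OF finite_nbh[OF fin]]) blast
qed

text \<open>Shrinking the host to the exact size \<open>2 * D' * n\<close> with
  \<open>D' = D * n ^ k\<close> fits the form demanded by the random neighbourhood lemmas, which
  then supply a neighbourhood of size at least \<open>D * n ^ k\<close>.\<close>

lemma ramsey_boundedI_double:
  assumes "\<And>n A W. n \<ge> 1 \<Longrightarrow> sgraph A \<Longrightarrow> indep_free A n W \<Longrightarrow> card W = 2 * (D * n ^ k) * n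
    \<Longrightarrow> \<exists>g. is_emb E V (A :: nat \<Rightarrow> nat \<Rightarrow> bool) W g"
  shows "ramsey_bounded E (Suc k) V"
proof -
  have "\<exists>g. is_emb E V A W g"
    if n: "n \<ge> 1" and A: "sgraph A" "indep_free A n W" and W: "(2 * D) * n ^ Suc k \<le> card W"
    for n and A :: "nat \<Rightarrow> nat \<Rightarrow> bool" and W
  proof -
    obtain W' where W': "W' \<subseteq> W" "card W' = (2 * D) * n ^ Suc k"
      using obtain_subset_with_card_n[OF W] by blast
    then have "card W' = 2 * (D * n ^ k) * n" by simp
    then obtain g where "is_emb E V A W' g"
      using assms[OF n A(1) indep_free_subset[OF A(2) W'(1)]] by blast
    then show ?thesis using is_emb_mono[OF _ W'(1)] by blast
  qed
  then show ?thesis unfolding ramsey_bounded_def by blast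
qed

text \<open>Here \<open>x\<close> has no neighbour in the rest, so \<open>x0\<close> can be fixed
  first: some vertex of \<open>U\<close> is bad with at most \<open>4 * card V * n\<close> others.
  Discarding these leaves room for the rest, and then every image of a \<open>y w\<close> has many
  common neighbours with \<open>x0\<close>. The summand \<open>4 * card V + 1\<close> in
  \<open>D\<close> pays for the discarded vertices and \<open>x0\<close>.\<close>

lemma ramsey_bounded_subdivided_star:
  assumes "sgraph E" "finite V" "v \<in> V" "x \<in> V" "v \<noteq> x" "I \<subseteq> V - {v, x}" "k \<ge> 1"
    and x: "\<And>u. u \<in> V \<Longrightarrow> E x u \<Longrightarrow> u \<in> insert v I"
    and I: "\<And>w. w \<in> I \<Longrightarrow> \<exists>y\<in>V - I - {v, x}. \<forall>u\<in>V. E w u \<longrightarrow> u = x \<or> u = y"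
    and rb: "ramsey_bounded E k (V - I - {v, x})"
  shows "ramsey_bounded E (Suc k) V"
proof -
  obtain C where C: "\<And>n A W. n \<ge> 1 \<Longrightarrow> sgraph A \<Longrightarrow> indep_free A n W \<Longrightarrow> C * n ^ k \<le> card W
    \<Longrightarrow> \<exists>g. is_emb E (V - I - {v, x}) (A :: nat \<Rightarrow> nat \<Rightarrow> bool) W g"
    using ramsey_boundedE[OF rb] by metis
  obtain y where y: "\<And>w. w \<in> I \<Longrightarrow> y w \<in> V - I - {v, x} \<and> (\<forall>u\<in>V. E w u \<longrightarrow> u = x \<or> u = y w)"
    using I by metis
  let ?h = "card V"
  show ?thesis
  proof (rule ramsey_boundedI_double[where D = "C + 4 * ?h + 1"])
    fix n W and A :: "nat \<Rightarrow> nat \<Rightarrow> bool"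
    assume n: "n \<ge> 1" and A: "sgraph A" "indep_free A n W"
      and W: "card W = 2 * ((C + 4 * ?h + 1) * n ^ k) * n"
    let ?D = "(C + 4 * ?h + 1) * n ^ k"
    let ?bad = "\<lambda>U a. {b \<in> U. card {u \<in> W. A a u \<and> A b u} < ?h}"
    have fin: "finite W" using A by (simp add: indep_free_def)
    have nk: "1 \<le> n ^ k" "n \<le> n ^ k" using n self_le_pow[OF n assms(7)] by auto
    then have "?D \<ge> 1" by (metis le_add2 mult_le_mono nat_mult_1)
    from neighbourhood_few_bad_pairs[OF A n W this, of ?h] obtain v0 where v0: "v0 \<in> W"
      and U: "?D \<le> card (nbh A W v0)"
        "(\<Sum>a\<in>nbh A W v0. card (?bad (nbh A W v0) a)) \<le> 4 * ?h * n * card (nbh A W v0)"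
      by blast
    let ?U = "nbh A W v0"
    have finU: "finite ?U" using fin by (rule finite_nbh)
    have "\<exists>x0\<in>?U. card (?bad ?U x0) \<le> 4 * ?h * n"
    proof (rule ccontr)
      assume "\<not> ?thesis"
      then have "4 * ?h * n + 1 \<le> card (?bad ?U a)" if "a \<in> ?U" for a
        using that by (simp add: not_le Suc_le_eq)
      then have "of_nat (card ?U) * (4 * ?h * n + 1) \<le> (\<Sum>a\<in>?U. card (?bad ?U a))"
        by (rule sum_bounded_below)
      also note U(2)
      finally have "card ?U = 0" by (simp add: algebra_simps)
      then show False using U(1) \<open>?D \<ge> 1\<close> by linarith
    qed
    then obtain x0 where x0: "x0 \<in> ?U" "card (?bad ?U x0) \<le> 4 * ?h * n" by blast
    let ?U' = "?U - insert x0 (?bad ?U x0)"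
    have "card (insert x0 (?bad ?U x0)) \<le> 4 * ?h * n + 1"
      using x0 finU by (simp add: card_insert_if)
    also have "\<dots> \<le> 4 * ?h * n ^ k + n ^ k" using nk by (intro add_mono mult_left_mono) auto
    finally have "C * n ^ k + card (insert x0 (?bad ?U x0)) \<le> card ?U"
      using U(1) by (simp add: add_mult_distrib)
    then have "C * n ^ k \<le> card ?U'"
      using finU x0 by (subst card_Diff_subset) auto
    moreover have "indep_free A n ?U'" using nbh_subset[of A W v0] by (intro indep_free_subset[OF A(2)]) auto
    ultimately obtain g where g: "is_emb E (V - I - {v, x}) A ?U' g" using C[OF n A(1)] by blast
    have gU: "g u \<in> ?U'" if "u \<in> V - I - {v, x}" for u
      using g that unfolding is_emb_def by blast
    show "\<exists>g. is_emb E V A W g"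
    proof (rule attach_common_neighbours[OF assms(1) A(1) assms(2) fin assms(3-6)])
      show "is_emb E (V - I - {v, x}) A ?U g" by (rule is_emb_mono[OF g]) auto
      show "x0 \<notin> g ` (V - I - {v, x})" using gU by blast
      show "A (g u) x0" if "u \<in> V - I - {v, x}" "E x u" for u
        using x[of u] that by blast
      show "y w \<in> V - I - {v, x} \<and> (\<forall>u\<in>V. E w u \<longrightarrow> u = x \<or> u = y w) \<and>
          ?h \<le> card {u \<in> W. A x0 u \<and> A (g (y w)) u}" if "w \<in> I" for w
        using y[OF that] gU[of "y w"] by auto
    qed (use x0 v0 in auto)
  qed
qed

text \<open>Now \<open>x\<close> has one neighbour \<open>z\<close> in the rest, so
  \<open>x0\<close> must be chosen last, among the neighbours of \<open>g z\<close> in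
  \<open>U\<close>. To make this possible the rest avoids vertices of \<open>U\<close> that are bad
  with many others or have small degree inside \<open>U\<close>. There may be about
  \<open>n ^ 2\<close> of the latter, whence \<open>k \<ge> 2\<close>.\<close>

lemma ramsey_bounded_subdivided_star_leaf:
  assumes "sgraph E" "finite V" "v \<in> V" "x \<in> V" "v \<noteq> x" "I \<subseteq> V - {v, x}" "k \<ge> 2"
    and z: "z \<in> V - I - {v, x}"
    and x: "\<And>u. u \<in> V \<Longrightarrow> E x u \<Longrightarrow> u \<in> insert v (insert z I)"
    and I: "\<And>w. w \<in> I \<Longrightarrow> \<exists>y\<in>V - I - {v, x}. \<forall>u\<in>V. E w u \<longrightarrow> u = x \<or> u = y"
    and rb: "ramsey_bounded E k (V - I - {v, x})"
  shows "ramsey_bounded E (Suc k) V"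
proof -
  obtain C where C: "\<And>n A W. n \<ge> 1 \<Longrightarrow> sgraph A \<Longrightarrow> indep_free A n W \<Longrightarrow> C * n ^ k \<le> card W
    \<Longrightarrow> \<exists>g. is_emb E (V - I - {v, x}) (A :: nat \<Rightarrow> nat \<Rightarrow> bool) W g"
    using ramsey_boundedE[OF rb] by metis
  obtain y where y: "\<And>w. w \<in> I \<Longrightarrow> y w \<in> V - I - {v, x} \<and> (\<forall>u\<in>V. E w u \<longrightarrow> u = x \<or> u = y w)"
    using I by metis
  define h where "h = card V"
  \<comment> \<open>Among the \<open>K * n\<close> neighbours of \<open>g z\<close>, at most
    \<open>h * (8 * h * n)\<close> are bad with the image of some \<open>y w\<close> and at most
    \<open>h\<close> are occupied; the final 1 leaves a vertex for \<open>x0\<close>.\<close>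
  define K where "K = 8 * h * h + h + 1"
  show ?thesis
  proof (rule ramsey_boundedI_double[where D = "2 * (C + K)"])
    fix n W and A :: "nat \<Rightarrow> nat \<Rightarrow> bool"
    assume n: "n \<ge> 1" and A: "sgraph A" "indep_free A n W"
      and W: "card W = 2 * (2 * (C + K) * n ^ k) * n"
    interpret A: sgraph A by fact
    let ?D = "2 * (C + K) * n ^ k"
    define bad where "bad U a = {b \<in> U. card {u \<in> W. A a u \<and> A b u} < h}" for U a
    have fin: "finite W" using A by (simp add: indep_free_def)
    have nk: "1 \<le> n ^ k" using n by simp
    have nn: "n * n \<le> n ^ k" using power_increasing[OF assms(7), of n] n by (simp add: power2_eq_square)
    have "2 * (C + K) \<ge> 1" by (simp add: K_def)
    then have D1: "?D \<ge> 1" using nk by (metis mult_le_mono nat_mult_1)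
    from neighbourhood_few_bad_pairs[OF A n W this, of h] obtain v0 where v0: "v0 \<in> W"
      and U0: "?D \<le> card (nbh A W v0)"
        "(\<Sum>a\<in>nbh A W v0. card (bad (nbh A W v0) a)) \<le> 4 * h * n * card (nbh A W v0)"
      unfolding bad_def by blast
    define U where "U = nbh A W v0"
    note U = U0[folded U_def]
    have UW: "U \<subseteq> W" unfolding U_def by (rule nbh_subset)
    have finU: "finite U" using fin UW finite_subset by blast
    have AU: "indep_free A n U" using A(2) UW by (rule indep_free_subset)
    let ?B = "{a \<in> U. 8 * h * n < card (bad U a)}"
    let ?L = "{a \<in> U. card (nbh A U a) < K * n}"
    \<comment> \<open>Markov's inequality: \<open>8 * h * n\<close> is twice the average number of
      bad partners. The lost half of \<open>U\<close> is the reason for the factor 2 in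
      \<open>D\<close>.\<close>
    have "2 * card ?B \<le> card U"
    proof (rule ccontr)
      assume *: "\<not> 2 * card ?B \<le> card U"
      have "8 * h * n + 1 \<le> card (bad U a)" if "a \<in> ?B" for a using that by simp
      then have "of_nat (card ?B) * (8 * h * n + 1) \<le> (\<Sum>a\<in>?B. card (bad U a))"
        by (rule sum_bounded_below)
      also have "\<dots> \<le> (\<Sum>a\<in>U. card (bad U a))" by (rule sum_mono2) (use finU in auto)
      also have "\<dots> \<le> 4 * h * n * (2 * card ?B)" using U(2) * by (meson le_trans mult_le_mono2 nat_le_linear)
      finally show False using * by (simp add: algebra_simps)
    qed
    moreover have "card ?L \<le> K * n ^ k"
    proof -
      have "card ?L < K * n * n"
        using n by (intro low_degree[OF A(1) AU]) (auto simp: K_def)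
      also have "K * n * n \<le> K * n ^ k" using nn by (simp add: mult.assoc)
      finally show ?thesis by simp
    qed
    moreover have "2 * (C * n ^ k) + 2 * (K * n ^ k) \<le> card U"
      using U(1) by (simp add: add_mult_distrib add_mult_distrib2 mult.assoc)
    \<comment> \<open>The bare arithmetic of the count, with \<open>u = card U\<close>,
      \<open>b = card ?B\<close>, \<open>l = card ?L\<close>, \<open>c = C * n ^ k\<close>,
      \<open>m = K * n ^ k\<close> and \<open>d = card (?B \<union> ?L)\<close>.\<close>
    moreover have "c + d \<le> u" if "2 * b \<le> u" "l \<le> m" "2 * c + 2 * m \<le> u" "d \<le> b + l"
      for b l m c u d :: nat using that by presburger
    ultimately have "C * n ^ k + card (?B \<union> ?L) \<le> card U"
      using card_Un_le[of ?B ?L] by blast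
    then have "C * n ^ k \<le> card (U - (?B \<union> ?L))"
      using finU by (subst card_Diff_subset) auto
    moreover have "indep_free A n (U - (?B \<union> ?L))" by (rule indep_free_subset[OF AU]) auto
    ultimately obtain g where g: "is_emb E (V - I - {v, x}) A (U - (?B \<union> ?L)) g" using C[OF n A(1)] by blast
    have gU: "g u \<in> U" "card (bad U (g u)) \<le> 8 * h * n" "K * n \<le> card (nbh A U (g u))"
      if "u \<in> V - I - {v, x}" for u
    proof -
      have "g u \<in> U - (?B \<union> ?L)" using g that unfolding is_emb_def by blast
      then show "g u \<in> U" "card (bad U (g u)) \<le> 8 * h * n" "K * n \<le> card (nbh A U (g u))" by auto
    qed
    let ?F = "(\<Union>w\<in>I. bad U (g (y w))) \<union> g ` (V - I - {v, x})"
    have IV: "I \<subseteq> V" "finite I" "card I \<le> h"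
      unfolding h_def using assms(2,6) by (auto intro: finite_subset card_mono)
    have "card (\<Union>w\<in>I. bad U (g (y w))) \<le> (\<Sum>w\<in>I. card (bad U (g (y w))))"
      by (rule card_UN_le[OF IV(2)])
    also have "\<dots> \<le> card I * (8 * h * n)"
      using sum_bounded_above[of I "\<lambda>w. card (bad U (g (y w)))" "8 * h * n"] gU(2) y by simp
    also have "\<dots> \<le> h * (8 * h * n)" using IV(3) by (rule mult_le_mono1)
    finally have 1: "card (\<Union>w\<in>I. bad U (g (y w))) \<le> h * (8 * h * n)" .
    have "card (g ` (V - I - {v, x})) \<le> card (V - I - {v, x})"
      using assms(2) by (intro card_image_le) auto
    also have "\<dots> \<le> h" unfolding h_def using assms(2) by (intro card_mono) auto
    also have "h \<le> h * n" using n by simp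
    finally have "card ?F \<le> h * (8 * h * n) + h * n"
      using 1 by (intro order_trans[OF card_Un_le]) simp
    also have "\<dots> < K * n" using n by (simp add: K_def algebra_simps)
    also have "\<dots> \<le> card (nbh A U (g z))" using gU(3)[OF z] .
    finally have "card ?F < card (nbh A U (g z))" .
    moreover have "finite ?F" using IV(2) finU assms(2) by (auto simp: bad_def)
    then have "nbh A U (g z) \<subseteq> ?F \<Longrightarrow> card (nbh A U (g z)) \<le> card ?F" by (rule card_mono)
    ultimately have "\<not> nbh A U (g z) \<subseteq> ?F" by linarith
    then obtain x0 where x0: "x0 \<in> nbh A U (g z)" "x0 \<notin> ?F" by blast
    then have x0U: "x0 \<in> U" "A (g z) x0" by (auto simp: nbh_def)
    show "\<exists>g. is_emb E V A W g"
    proof (rule attach_common_neighbours[OF assms(1) A(1) assms(2) fin assms(3-6)])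
      show "is_emb E (V - I - {v, x}) A U g" by (rule is_emb_mono[OF g]) auto
      show "U \<subseteq> nbh A W v0" by (simp add: U_def)
      show "x0 \<notin> g ` (V - I - {v, x})" using x0 by blast
      show "A (g u) x0" if "u \<in> V - I - {v, x}" "E x u" for u
        using x[of u] that x0U by blast
      show "y w \<in> V - I - {v, x} \<and> (\<forall>u\<in>V. E w u \<longrightarrow> u = x \<or> u = y w) \<and>
          card V \<le> card {u \<in> W. A x0 u \<and> A (g (y w)) u}" if w: "w \<in> I" for w
      proof -
        have "x0 \<notin> bad U (g (y w))" using x0(2) w by blast
        then have "h \<le> card {u \<in> W. A (g (y w)) u \<and> A x0 u}" using x0U by (simp add: bad_def not_less)
        moreover have "{u \<in> W. A (g (y w)) u \<and> A x0 u} = {u \<in> W. A x0 u \<and> A (g (y w)) u}" by blast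
        ultimately show ?thesis using y[OF w] by (simp add: h_def)
      qed
    qed (use x0U v0 in auto)
  qed
qed

text \<open>Edges in fewer than \<open>h\<close> triangles form a graph of maximum degree below \<open>h n\<close>, since the
  neighbourhood of a vertex in this graph has degrees below \<open>h\<close>.\<close>

lemma ramsey_bounded_triangles:
  assumes "sgraph E" "finite V" "v \<in> V" "I \<subseteq> V - {v}" "k \<ge> 1"
    and I: "\<And>w. w \<in> I \<Longrightarrow> \<exists>a\<in>V - I - {v}. \<exists>b\<in>V - I - {v}. E a b \<and> (\<forall>u\<in>V. E w u \<longrightarrow> u = a \<or> u = b)"
    and rb: "ramsey_bounded E k (V - I - {v})"
  shows "ramsey_bounded E (Suc k) V"
proof -
  obtain C where C: "\<And>n A W. n \<ge> 1 \<Longrightarrow> sgraph A \<Longrightarrow> indep_free A n W \<Longrightarrow> C * n ^ k \<le> card W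
    \<Longrightarrow> \<exists>g. is_emb E (V - I - {v}) (A :: nat \<Rightarrow> nat \<Rightarrow> bool) W g"
    using ramsey_boundedE[OF rb] by metis
  define h where "h = card V"
  have h: "h \<ge> 1" using assms(2,3) unfolding h_def by (metis card_gt_0_iff Suc_leI One_nat_def empty_iff)
  show ?thesis
  proof (rule ramsey_boundedI_double[where D = "C + 2 * h * h + 1"])
    fix n W and A :: "nat \<Rightarrow> nat \<Rightarrow> bool"
    assume n: "n \<ge> 1" and A: "sgraph A" "indep_free A n W"
      and W: "card W = 2 * ((C + 2 * h * h + 1) * n ^ k) * n"
    interpret A: sgraph A by fact
    let ?D = "(C + 2 * h * h + 1) * n ^ k"
    let ?P = "\<lambda>a b. A a b \<and> card {u \<in> W. A a u \<and> A b u} < h"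
    have fin: "finite W" using A by (simp add: indep_free_def)
    have nk: "1 \<le> n ^ k" "n \<le> n ^ k" using n self_le_pow[OF n assms(5)] by auto
    then have D1: "?D \<ge> 1" by (metis le_add2 mult_le_mono nat_mult_1)
    have light: "card {b \<in> W. ?P a b} \<le> h * n" for a
    proof -
      let ?N = "{b \<in> W. ?P a b}"
      have "card (nbh A ?N b) < h" if "b \<in> ?N" for b
      proof -
        have "card (nbh A ?N b) \<le> card {u \<in> W. A a u \<and> A b u}"
          using fin by (intro card_mono) (auto simp: nbh_def)
        then show ?thesis using that by simp
      qed
      then have "{w \<in> ?N. card (nbh A ?N w) < h} = ?N" by blast
      moreover have "indep_free A n ?N" by (rule indep_free_subset[OF A(2)]) auto
      ultimately show ?thesis using low_degree[OF A(1) _ n h, of ?N] by simp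
    qed
    obtain v0 where v0: "v0 \<in> W" "?D \<le> card (nbh A W v0)"
      and b: "card {(a, b). a \<in> nbh A W v0 \<and> b \<in> nbh A W v0 \<and> ?P a b} * card W
        \<le> 2 * h * card {(a, b). a \<in> W \<and> b \<in> W \<and> ?P a b}"
      using neighbourhood_few_pairs[OF A n W D1, of ?P h] by auto
    let ?U = "nbh A W v0"
    let ?bad = "{(a, b). a \<in> ?U \<and> b \<in> ?U \<and> ?P a b}"
    have finU: "finite ?U" using fin by (rule finite_nbh)
    \<comment> \<open>Only edges are counted here, so \<open>card W * h * n\<close> replaces the
      trivial \<open>card W ^ 2\<close>. As a result the whole neighbourhood contains at most
      \<open>2 * h * h * n\<close> bad pairs, not merely that many on average per vertex.\<close>
    have "card {(a, b). a \<in> W \<and> b \<in> W \<and> ?P a b} \<le> card W * (h * n)"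
      unfolding card_pairs[OF fin] using sum_bounded_above[of W, OF light] by simp
    then have "2 * h * card {(a, b). a \<in> W \<and> b \<in> W \<and> ?P a b} \<le> 2 * h * (card W * (h * n))"
      by (rule mult_le_mono2)
    also have "2 * h * (card W * (h * n)) = (2 * h * h * n) * card W" by (simp only: mult_ac)
    finally have "card ?bad * card W \<le> (2 * h * h * n) * card W" using b by (rule order_trans[rotated])
    moreover have "card W > 0" using v0(1) fin card_gt_0_iff by blast
    ultimately have "card ?bad \<le> 2 * h * h * n" by simp
    moreover have "2 * h * h * n \<le> 2 * h * h * n ^ k" using nk(2) by (rule mult_le_mono2)
    moreover have fb: "finite ?bad" by (rule finite_subset[of _ "?U \<times> ?U"]) (use finU in auto)
    then have "card (fst ` ?bad) \<le> card ?bad" by (rule card_image_le)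
    ultimately have "card (fst ` ?bad) \<le> 2 * h * h * n ^ k" by linarith
    moreover have "C * n ^ k + 2 * h * h * n ^ k \<le> card ?U"
      using v0(2) by (simp add: add_mult_distrib)
    ultimately have "C * n ^ k + card (fst ` ?bad) \<le> card ?U" by linarith
    \<comment> \<open>There are so few bad pairs that the first component of each one can be
      deleted; the remaining set spans no bad pair at all.\<close>
    then have "C * n ^ k \<le> card (?U - fst ` ?bad)"
      using fb by (subst card_Diff_subset) auto
    moreover have "indep_free A n (?U - fst ` ?bad)"
      using nbh_subset[of A W v0] by (intro indep_free_subset[OF A(2)]) auto
    ultimately obtain g where g: "is_emb E (V - I - {v}) A (?U - fst ` ?bad) g" using C[OF n A(1)] by blast
    have gU: "g u \<in> ?U - fst ` ?bad" if "u \<in> V - I - {v}" for u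
      using g that unfolding is_emb_def by blast
    have "is_emb E (insert v (V - I - {v})) A W (g(v := v0))"
    proof (rule is_emb_insert)
      show "is_emb E (V - I - {v}) A W g"
        using nbh_subset[of A W v0] by (intro is_emb_mono[OF g]) auto
      show "v0 \<notin> g ` (V - I - {v})" using gU A.irrefl[of v0] unfolding nbh_def by blast
      show "A (g u) v0" if "u \<in> V - I - {v}" for u
        using gU[OF that] A.sym unfolding nbh_def by blast
    qed (use assms(1) A(1) v0 in auto)
    moreover have "insert v (V - I - {v}) = V - I" using assms(3,4) by auto
    ultimately have g': "is_emb E (V - I) A W (g(v := v0))" by simp
    show "\<exists>f. is_emb E V A W f"
    proof (rule is_emb_extend[OF assms(1) A(1) assms(2) fin _ _ g'])
      show "I \<subseteq> V" using assms(4) by auto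
      show "\<not> E w u" if "w \<in> I" "u \<in> I" for w u
        using I[OF that(1)] that assms(4) by blast
      fix w assume "w \<in> I"
      from I[OF this] obtain a b where ab: "a \<in> V - I - {v}" "b \<in> V - I - {v}" "E a b"
        and w: "\<And>u. u \<in> V \<Longrightarrow> E w u \<Longrightarrow> u = a \<or> u = b" by blast
      have "A (g a) (g b)" using g ab unfolding is_emb_def by blast
      moreover have "(g a, g b) \<notin> ?bad" using gU[OF ab(1)] by force
      ultimately have "h \<le> card {u \<in> W. A (g a) u \<and> A (g b) u}"
        using gU[OF ab(1)] gU[OF ab(2)] by (simp add: not_less)
      also have "\<dots> \<le> card {z \<in> W. \<forall>u\<in>V - I. E w u \<longrightarrow> A ((g(v := v0)) u) z}"
      proof (rule card_mono)
        show "{u \<in> W. A (g a) u \<and> A (g b) u} \<subseteq> {z \<in> W. \<forall>u\<in>V - I. E w u \<longrightarrow> A ((g(v := v0)) u) z}"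
          using w ab by (auto dest: w)
      qed (use fin in auto)
      finally show "card V \<le> card {z \<in> W. \<forall>u\<in>V - I. E w u \<longrightarrow> A ((g(v := v0)) u) z}"
        unfolding h_def .
    qed
  qed
qed

section \<open>Excess and blocks\<close>

text \<open>This is twice the difference of the numbers of edges and vertices.\<close>

definition excess :: "('a \<Rightarrow> 'a \<Rightarrow> bool) \<Rightarrow> 'a set \<Rightarrow> int" where
  "excess E S = (\<Sum>v\<in>S. int (card (nbh E S v)) - 2)"

text \<open>Quantifying over subsets makes the condition hereditary, also for disconnected pieces.
  \<open>S \<noteq> {}\<close> matters for negative \<open>j\<close>: the empty set has excess 0,
  and \<open>j = - 2\<close> describes forests.\<close>

definition sparse :: "('a \<Rightarrow> 'a \<Rightarrow> bool) \<Rightarrow> int \<Rightarrow> 'a set \<Rightarrow> bool" where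
  "sparse E j V \<longleftrightarrow> (\<forall>S\<subseteq>V. S \<noteq> {} \<longrightarrow> excess E S \<le> j)"

definition connected_in :: "('a \<Rightarrow> 'a \<Rightarrow> bool) \<Rightarrow> 'a set \<Rightarrow> bool" where
  "connected_in E V \<longleftrightarrow> (\<forall>S\<subseteq>V. S \<noteq> {} \<longrightarrow> S \<noteq> V \<longrightarrow> (\<exists>u\<in>S. \<exists>v\<in>V - S. E u v))"

text \<open>Exactly the sets on which neither the leaf reduction nor the gluing reduction makes
  progress: 2-connected graphs with at least 3 vertices, and the empty set.\<close>

definition block :: "('a \<Rightarrow> 'a \<Rightarrow> bool) \<Rightarrow> 'a set \<Rightarrow> bool" where
  "block E V \<longleftrightarrow> (\<forall>v\<in>V. 2 \<le> card (nbh E V v)) \<and>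
     (\<forall>S T r. S \<union> T = V \<longrightarrow> S \<inter> T = {r} \<longrightarrow> (\<forall>s\<in>S - {r}. \<forall>t\<in>T - {r}. \<not> E s t) \<longrightarrow> S = V \<or> T = V)"

lemma sparse_subset: "sparse E j V \<Longrightarrow> W \<subseteq> V \<Longrightarrow> sparse E j W"
  unfolding sparse_def by (meson order_trans)

lemma sparse_le: "sparse E i V \<Longrightarrow> i \<le> j \<Longrightarrow> sparse E j V"
  unfolding sparse_def by (meson order_trans)

lemma excess_empty [simp]: "excess E {} = 0"
  by (simp add: excess_def)

context sgraph
begin

lemma excess_insert:
  assumes "finite S" "v \<notin> S"
  shows "excess E (insert v S) = excess E S + 2 * int (card (nbh E S v)) - 2"
proof -
  have v: "nbh E (insert v S) v = nbh E S v" using irrefl by (auto simp: nbh_def)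
  have u: "int (card (nbh E (insert v S) u)) = int (card (nbh E S u)) + (if E v u then 1 else 0)"
    if "u \<in> S" for u
  proof (cases "E v u")
    case True
    then have "nbh E (insert v S) u = insert v (nbh E S u)" "v \<notin> nbh E S u"
      using assms(2) sym by (auto simp: nbh_def)
    then show ?thesis using True finite_nbh[OF assms(1)] by simp
  next
    case False
    then have "nbh E (insert v S) u = nbh E S u" using sym by (auto simp: nbh_def)
    then show ?thesis using False by simp
  qed
  have "(\<Sum>u\<in>S. if E v u then 1 else 0 :: int) = int (card (nbh E S v))"
    using assms(1) by (simp add: nbh_def sum.inter_filter[symmetric])
  moreover have "(\<Sum>u\<in>S. int (card (nbh E (insert v S) u)) - 2)
      = (\<Sum>u\<in>S. (int (card (nbh E S u)) - 2) + (if E v u then 1 else 0))"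
    by (rule sum.cong) (simp_all add: u)
  ultimately show ?thesis using assms by (simp add: excess_def v sum.distrib)
qed

lemma excess_remove:
  assumes "finite S" "v \<in> S"
  shows "excess E (S - {v}) = excess E S - 2 * int (card (nbh E S v)) + 2"
proof -
  have "nbh E (S - {v}) v = nbh E S v" using irrefl by (auto simp: nbh_def)
  then show ?thesis using excess_insert[of "S - {v}" v] assms by (simp add: insert_absorb)
qed

lemma even_excess: "finite S \<Longrightarrow> even (excess E S)"
  by (induction S rule: finite_induct) (simp_all add: excess_insert)

text \<open>Grow \<open>S\<close> to \<open>V\<close> one vertex at a time. By connectedness the
  next vertex can be taken adjacent to the current set, and then it brings at least as many edges as
  vertices.\<close>

lemma excess_mono:
  assumes "connected_in E V" "finite V" "S \<subseteq> V" "S \<noteq> {}"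
  shows "excess E S \<le> excess E V"
  using assms(3,4)
proof (induction "card (V - S)" arbitrary: S)
  case 0
  then have "S = V" using assms(2) by auto
  then show ?case by simp
next
  case (Suc m)
  then have "S \<noteq> V" by auto
  then obtain u v where uv: "u \<in> S" "v \<in> V - S" "E u v"
    using assms(1) Suc.prems unfolding connected_in_def by blast
  have fin: "finite S" using Suc.prems assms(2) finite_subset by blast
  have "V - insert v S = (V - S) - {v}" by auto
  then have "m = card (V - insert v S)" using Suc.hyps(2) uv assms(2) by simp
  then have IH: "excess E (insert v S) \<le> excess E V" using Suc.hyps(1) Suc.prems uv by simp
  have "u \<in> nbh E S v" using uv sym by (simp add: nbh_def)
  then have "card (nbh E S v) \<ge> 1" using finite_nbh[OF fin] by (metis One_nat_def Suc_leI card_gt_0_iff empty_iff)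
  then show ?case using IH excess_insert[OF fin] uv by auto
qed

text \<open>The number of edges is supermodular and the number of vertices modular. It is used to
  intersect two sets of large excess whose union cannot have larger excess.\<close>

lemma excess_supermodular:
  assumes "finite S" "finite T"
  shows "excess E S + excess E T \<le> excess E (S \<union> T) + excess E (S \<inter> T)"
proof -
  let ?U = "S \<union> T"
  let ?f = "\<lambda>X v. if v \<in> X then int (card (nbh E X v)) - 2 else 0"
  have eq: "excess E X = (\<Sum>v\<in>?U. ?f X v)" if "X \<subseteq> ?U" for X
  proof -
    have "(\<Sum>v\<in>?U. ?f X v) = (\<Sum>v\<in>X. ?f X v)"
      using assms that by (intro sum.mono_neutral_right) auto
    then show ?thesis by (simp add: excess_def)
  qed
  have le: "?f S v + ?f T v \<le> ?f ?U v + ?f (S \<inter> T) v" if "v \<in> ?U" for v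
  proof -
    have un: "nbh E ?U v = nbh E S v \<union> nbh E T v" "nbh E (S \<inter> T) v = nbh E S v \<inter> nbh E T v"
      by (auto simp: nbh_def)
    have fin: "finite (nbh E S v)" "finite (nbh E T v)" using assms by (auto intro: finite_nbh)
    have "card (nbh E S v) + card (nbh E T v) = card (nbh E ?U v) + card (nbh E (S \<inter> T) v)"
      unfolding un by (rule card_Un_Int[OF fin])
    moreover have "card (nbh E S v) \<le> card (nbh E ?U v)" "card (nbh E T v) \<le> card (nbh E ?U v)"
      unfolding un using fin by (auto intro: card_mono)
    ultimately show ?thesis using that by auto
  qed
  have "excess E S + excess E T = (\<Sum>v\<in>?U. ?f S v + ?f T v)"
    using eq[of S] eq[of T] by (simp add: sum.distrib)
  also have "\<dots> \<le> (\<Sum>v\<in>?U. ?f ?U v + ?f (S \<inter> T) v)" by (rule sum_mono[OF le])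
  also have "\<dots> = excess E ?U + excess E (S \<inter> T)"
    using eq[of ?U] eq[of "S \<inter> T"] by (simp only: sum.distrib) (simp add: le_infI1)
  finally show ?thesis .
qed

text \<open>This is how 2-connectedness is applied: if every edge leaving \<open>S\<close> started
  at \<open>s\<close>, then \<open>S\<close> and \<open>insert s (V - S)\<close> would form a
  separation at \<open>s\<close>.\<close>

lemma block_cut:
  assumes "block E V" "S \<subseteq> V" "s \<in> S" "S \<noteq> V" "S \<noteq> {s}"
  obtains u v where "u \<in> S - {s}" "v \<in> V - S" "E u v"
proof -
  have "S \<union> insert s (V - S) = V" "S \<inter> insert s (V - S) = {s}" using assms by auto
  moreover have "S \<noteq> V \<and> insert s (V - S) \<noteq> V" using assms by auto
  ultimately have "\<not> (\<forall>u\<in>S - {s}. \<forall>t\<in>insert s (V - S) - {s}. \<not> E u t)"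
    using assms(1) unfolding block_def by blast
  then show ?thesis using that by blast
qed

lemma block_degree: "block E V \<Longrightarrow> v \<in> V \<Longrightarrow> 2 \<le> card (nbh E V v)"
  by (simp add: block_def)

lemma block_connected:
  assumes "block E V"
  shows "connected_in E V"
  unfolding connected_in_def
proof (intro allI impI)
  fix S assume S: "S \<subseteq> V" "S \<noteq> {}" "S \<noteq> V"
  then obtain s where s: "s \<in> S" by blast
  show "\<exists>u\<in>S. \<exists>v\<in>V - S. E u v"
  proof (cases "S = {s}")
    case True
    have "nbh E V s \<noteq> {}" using block_degree[OF assms, of s] s S by auto
    then show ?thesis using True irrefl by (auto simp: nbh_def)
  next
    case False
    from block_cut[OF assms S(1) s S(3) this] obtain u v where "u \<in> S - {s}" "v \<in> V - S" "E u v" .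
    then show ?thesis by blast
  qed
qed

lemma block_remove_connected:
  assumes "block E V" "v \<in> V"
  shows "connected_in E (V - {v})"
  unfolding connected_in_def
proof (intro allI impI)
  fix S assume S: "S \<subseteq> V - {v}" "S \<noteq> {}" "S \<noteq> V - {v}"
  have "insert v S \<subseteq> V" "v \<in> insert v S" "insert v S \<noteq> V" "insert v S \<noteq> {v}"
    using S assms(2) by auto
  from block_cut[OF assms(1) this] obtain u w where "u \<in> insert v S - {v}" "w \<in> V - insert v S" "E u w" .
  then show "\<exists>u\<in>S. \<exists>w\<in>V - {v} - S. E u w" by blast
qed

text \<open>A block minus a vertex is still connected, so by \<open>excess_mono\<close> its own
  excess bounds that of all its nonempty subsets.\<close>

lemma block_remove_sparse:
  assumes "block E V" "finite V" "v \<in> V"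
  shows "sparse E (excess E V - 2 * int (card (nbh E V v)) + 2) (V - {v})"
  unfolding sparse_def excess_remove[OF assms(2,3), symmetric]
  using excess_mono[OF block_remove_connected[OF assms(1,3)]] assms(2) by simp

text \<open>Induction on \<open>V\<close>: a set that is no block has a vertex of degree at most 1
  or a separation at one vertex, and both reductions keep the exponent. \<open>P\<close> is carried
  along to the smaller sets, hence hereditary.\<close>

lemma ramsey_bounded_by_blocks:
  assumes "\<And>V. finite V \<Longrightarrow> P V \<Longrightarrow> block E V \<Longrightarrow> ramsey_bounded E k V"
    and hereditary: "\<And>V W. P V \<Longrightarrow> W \<subseteq> V \<Longrightarrow> P W"
    and "k \<ge> 1" "finite V" "P V"
  shows "ramsey_bounded E k V"
  using assms(4,5)
proof (induction V rule: finite_psubset_induct)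
  case (psubset V)
  have IH: "ramsey_bounded E k W" if "W \<subset> V" for W
    using psubset.IH[OF that] hereditary[OF psubset.prems] that by blast
  show ?case
  proof (cases "block E V")
    case True
    then show ?thesis using assms(1) psubset by blast
  next
    case False
    then consider v where "v \<in> V" "\<not> 2 \<le> card (nbh E V v)"
      | S T r where "S \<union> T = V" "S \<inter> T = {r}" "\<forall>s\<in>S - {r}. \<forall>t\<in>T - {r}. \<not> E s t" "S \<noteq> V" "T \<noteq> V"
      unfolding block_def by blast
    then show ?thesis
    proof cases
      case 1
      have "ramsey_bounded E k (insert v (V - {v}))"
      proof (rule ramsey_bounded_leaf[OF sgraph_axioms _ assms(3)])
        show "ramsey_bounded E k (V - {v})" using 1 by (intro IH) auto
        show "u = u'" if "u \<in> V - {v}" "u' \<in> V - {v}" "E v u" "E v u'" for u u'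
        proof -
          have "card (nbh E V v) \<le> Suc 0" using 1 by simp
          then show ?thesis
            using card_le_Suc0_iff_eq[OF finite_nbh[OF psubset.hyps], of E v] that by (auto simp: nbh_def)
        qed
      qed (use psubset.hyps in auto)
      then show ?thesis using 1 by (simp add: insert_absorb)
    next
      case 2
      then show ?thesis
        by (intro ramsey_bounded_glue[OF sgraph_axioms psubset.hyps 2(1,2)] IH) auto
    qed
  qed
qed

section \<open>Linear and quadratic bounds\<close>

lemma block_excess_nonneg: "block E V \<Longrightarrow> 0 \<le> excess E V"
  using block_degree unfolding excess_def by (intro sum_nonneg) fastforce

lemma ramsey_bounded_forest:
  assumes "finite V" "sparse E (- 2) V"
  shows "ramsey_bounded E 1 V"
proof (rule ramsey_bounded_by_blocks[where P = "sparse E (- 2)"])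
  fix V assume V: "finite V" "sparse E (- 2) V" "block E V"
  have "V = {}"
  proof (rule ccontr)
    assume "V \<noteq> {}"
    then have "excess E V \<le> - 2" using V(2) by (simp add: sparse_def)
    then show False using block_excess_nonneg[OF V(3)] by simp
  qed
  then show "ramsey_bounded E 1 V" by (simp add: ramsey_bounded_empty)
qed (simp_all add: assms, rule sparse_subset)

lemma excess_pos_degree:
  assumes "0 < excess E V"
  obtains v where "v \<in> V" "3 \<le> card (nbh E V v)"
proof -
  have "\<exists>v\<in>V. 3 \<le> card (nbh E V v)"
  proof (rule ccontr)
    assume "\<not> ?thesis"
    then have "excess E V \<le> 0" unfolding excess_def by (intro sum_nonpos) force
    then show False using assms by simp
  qed
  then show ?thesis using that by blast
qed

lemma ramsey_bounded_quadratic: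
  assumes "finite V" "sparse E 2 V"
  shows "ramsey_bounded E 2 V"
proof (rule ramsey_bounded_by_blocks[where P = "sparse E 2"])
  fix V assume V: "finite V" "sparse E 2 V" "block E V"
  show "ramsey_bounded E 2 V"
  proof (cases "V = {}")
    case True
    then show ?thesis by (simp add: ramsey_bounded_empty)
  next
    case False
    then have "excess E V \<le> 2" using V(2) by (simp add: sparse_def)
    \<comment> \<open>Such a vertex leaves a forest. For positive excess, at most 2, a vertex of
      degree 3 will do since 2 + 4 = 6; otherwise degree 2 is enough.\<close>
    have "\<exists>v\<in>V. excess E V + 4 \<le> 2 * int (card (nbh E V v))"
    proof (cases "0 < excess E V")
      case True
      then obtain v where "v \<in> V" "3 \<le> card (nbh E V v)" using excess_pos_degree by blast
      then show ?thesis using \<open>excess E V \<le> 2\<close> by force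
    next
      case False
      then show ?thesis using \<open>V \<noteq> {}\<close> block_degree[OF V(3)] by force
    qed
    then obtain v where v: "v \<in> V" "excess E V + 4 \<le> 2 * int (card (nbh E V v))" by blast
    have "sparse E (- 2) (V - {v})"
      by (rule sparse_le[OF block_remove_sparse[OF V(3,1) v(1)]]) (use v(2) in simp)
    then have "ramsey_bounded E 1 (V - {v})" by (rule ramsey_bounded_forest[OF finite_Diff[OF V(1)]])
    then have "ramsey_bounded E (Suc 1) V" by (rule ramsey_bounded_apex[OF sgraph_axioms _ v(1)])
    then show ?thesis by (simp add: numeral_2_eq_2)
  qed
qed (simp_all add: assms, rule sparse_subset)

section \<open>Excess 8 with vertices of degree 2\<close>

lemma nbhD: "nbh E V v = N \<Longrightarrow> u \<in> V \<Longrightarrow> E v u \<Longrightarrow> u \<in> N"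
  by (auto simp: nbh_def)

lemma nbhE: "nbh E V v = N \<Longrightarrow> u \<in> N \<Longrightarrow> u \<in> V \<and> E v u \<and> E u v \<and> u \<noteq> v"
  using sym irrefl by (auto simp: nbh_def)

lemma sparseD: "sparse E j V \<Longrightarrow> S \<subseteq> V \<Longrightarrow> S \<noteq> {} \<Longrightarrow> excess E S \<le> j"
  by (simp add: sparse_def)

lemma not_sparse_quadratic:
  assumes "finite V" "\<not> sparse E 2 V"
  obtains S where "S \<subseteq> V" "S \<noteq> {}" "4 \<le> excess E S"
proof -
  obtain S where S: "S \<subseteq> V" "S \<noteq> {}" "2 < excess E S"
    using assms(2) unfolding sparse_def not_le[symmetric] by blast
  have "even (excess E S)" using even_excess finite_subset[OF S(1) assms(1)] .
  then have "4 \<le> excess E S" using S(3) by presburger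
  then show ?thesis using that S by blast
qed

text \<open>On at most three vertices all degrees are at most 2, so no summand of the excess is
  positive.\<close>

lemma excess_ge_4_card:
  assumes "finite S" "4 \<le> excess E S"
  shows "4 \<le> card S"
proof (rule ccontr)
  assume c: "\<not> 4 \<le> card S"
  have "int (card (nbh E S v)) - 2 \<le> 0" if "v \<in> S" for v
  proof -
    have "nbh E S v \<subseteq> S - {v}" using irrefl by (auto simp: nbh_def)
    then have "card (nbh E S v) \<le> card (S - {v})" using assms(1) by (intro card_mono) auto
    then show ?thesis using c that assms(1) by simp
  qed
  then have "excess E S \<le> 0" unfolding excess_def by (rule sum_nonpos)
  then show False using assms(2) by simp
qed

text \<open>With \<open>I = {w, p}\<close> it remains to find \<open>v\<close> such that deleting
  \<open>v\<close> destroys every set of excess at least 4 in \<open>V - {x, w, p}\<close>. These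
  sets are closed under intersection, since \<open>V - {x}\<close> has no set of excess above 4; so
  any vertex of the smallest one works.\<close>

lemma ramsey_bounded_cubic_two_degree_two:
  assumes fin: "finite V" and bl: "block E V" and ex: "excess E V = 8" and x: "x \<in> V"
    and Nx: "nbh E V x = {w, p, q}" "w \<noteq> p" "w \<noteq> q" "p \<noteq> q"
    and Nw: "nbh E V w = {x, y}" "y \<noteq> x" and Np: "nbh E V p = {x, y'}" "y' \<noteq> x"
  shows "ramsey_bounded E 3 V"
proof -
  have V: "w \<in> V" "p \<in> V" "q \<in> V" "y \<in> V" "y' \<in> V"
    and ne: "w \<noteq> x" "p \<noteq> x" "q \<noteq> x" "y \<noteq> w" "y' \<noteq> p"
    using nbhE[OF Nx(1), of w] nbhE[OF Nx(1), of p] nbhE[OF Nx(1), of q]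
      nbhE[OF Nw(1), of y] nbhE[OF Np(1), of y'] by simp_all
  \<comment> \<open>If adjacent, \<open>w\<close> and \<open>p\<close> would form a triangle with
    \<open>x\<close> that is attached to the rest at \<open>x\<close> alone.\<close>
  have wp: "\<not> E w p"
  proof
    assume wp: "E w p"
    have y: "y = p" "y' = w" using nbhD[OF Nw(1) V(2) wp] nbhD[OF Np(1) V(1) sym[OF wp]] ne by auto
    have S: "{w, p, x} \<subseteq> V" "x \<in> {w, p, x}" "{w, p, x} \<noteq> V" "{w, p, x} \<noteq> {x}"
      using V x Nx ne by auto
    obtain u v where uv: "u \<in> {w, p, x} - {x}" "v \<in> V - {w, p, x}" "E u v"
      by (rule block_cut[OF bl S])
    then show False using nbhD[OF Nw(1), of v] nbhD[OF Np(1), of v] y by auto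
  qed
  have ynp: "y \<noteq> p" "y' \<noteq> w" using wp nbhE[OF Nw(1), of y] nbhE[OF Np(1), of y'] by auto
  let ?U = "V - {x} - {w} - {p}"
  have sp: "sparse E 4 (V - {x})"
    by (rule sparse_le[OF block_remove_sparse[OF bl fin x]]) (use Nx ex in simp)
  have "nbh E (V - {x}) w = {y}" using Nw by (auto simp: nbh_def)
  moreover have "nbh E (V - {x} - {w}) p = {y'}" using Np ynp by (auto simp: nbh_def)
  ultimately have "excess E ?U = 4"
    using excess_remove[OF fin x] excess_remove[of "V - {x}" w] excess_remove[of "V - {x} - {w}" p] fin V ne Nx ex
    by simp
  then have "?U \<subseteq> ?U \<and> 4 \<le> excess E ?U" by simp
  from ex_has_least_nat[where P = "\<lambda>S. S \<subseteq> ?U \<and> 4 \<le> excess E S" and m = card, OF this]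
  obtain S where S: "S \<subseteq> ?U" "4 \<le> excess E S"
    and min: "\<forall>T. T \<subseteq> ?U \<and> 4 \<le> excess E T \<longrightarrow> card S \<le> card T"
    by (elim exE conjE)
  have finS: "finite S" by (rule finite_subset[OF S(1)]) (use fin in simp)
  have "4 \<le> card S" by (rule excess_ge_4_card[OF finS S(2)])
  \<comment> \<open>\<open>v\<close> must differ from \<open>y\<close> and \<open>y'\<close>, which
    have to stay in the rest as the outer neighbours of \<open>w\<close> and \<open>p\<close>. Four
    vertices in \<open>S\<close> leave a choice.\<close>
  then have "\<not> S \<subseteq> {y, y'}" using card_mono[of "{y, y'}" S] by (auto simp: card_insert_if split: if_splits)
  then obtain v where v: "v \<in> S" "v \<noteq> y" "v \<noteq> y'" by blast
  have vV: "v \<in> V" "v \<noteq> x" "v \<noteq> w" "v \<noteq> p" using v S(1) by auto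
  let ?W = "V - {w, p} - {v, x}"
  have "sparse E 2 ?W"
  proof (rule ccontr)
    assume "\<not> sparse E 2 ?W"
    then obtain T where T: "T \<subseteq> ?W" "T \<noteq> {}" "4 \<le> excess E T"
      using not_sparse_quadratic[of ?W] fin by blast
    have finT: "finite T" by (rule finite_subset[OF T(1)]) (use fin in simp)
    have "excess E (S \<union> T) \<le> 4" by (rule sparseD[OF sp]) (use S(1) T(1,2) in auto)
    then have "4 \<le> excess E (S \<inter> T)" using excess_supermodular[OF finS finT] S(2) T(3) by linarith
    then have "card S \<le> card (S \<inter> T)" using S(1) by (intro min[rule_format]) auto
    moreover have "S \<inter> T \<subset> S" using v T(1) by auto
    ultimately show False using psubset_card_mono[OF finS] by (metis not_less)
  qed
  then have rb: "ramsey_bounded E 2 ?W" using fin by (intro ramsey_bounded_quadratic) auto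
  \<comment> \<open>The neighbour of \<open>x\<close> outside \<open>{v, w, p}\<close> is
    \<open>q\<close>. If \<open>v\<close> is already \<open>q\<close>, there is none, and
    \<open>y\<close> serves as a harmless placeholder in the rest.\<close>
  define z where "z = (if v = q then y else q)"
  have "ramsey_bounded E (Suc 2) V"
  proof (rule ramsey_bounded_subdivided_star_leaf[OF sgraph_axioms fin vV(1) x vV(2) _ _ _ _ _ rb])
    show "z \<in> ?W" using V ne Nx ynp v Nw by (auto simp: z_def)
    show "u \<in> insert v (insert z {w, p})" if "u \<in> V" "E x u" for u
      using nbhD[OF Nx(1) that] by (auto simp: z_def)
    show "\<exists>y\<in>?W. \<forall>u\<in>V. E w' u \<longrightarrow> u = x \<or> u = y" if "w' \<in> {w, p}" for w'
    proof -
      have "y \<in> ?W" "y' \<in> ?W" using V v ne ynp Nw Np by auto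
      then show ?thesis using that nbhD[OF Nw(1)] nbhD[OF Np(1)] by blast
    qed
  qed (use V vV ne in auto)
  then show ?thesis by (simp add: numeral_3_eq_3 numeral_2_eq_2)
qed

text \<open>With \<open>I = {w}\<close>, one of \<open>p\<close> and \<open>q\<close> plays
  \<open>v\<close> and the other plays \<open>z\<close>. Since \<open>y\<close> must stay in the
  rest, the choice is forced when \<open>y\<close> is \<open>p\<close> or \<open>q\<close>;
  otherwise at least one of the two choices works.\<close>

lemma ramsey_bounded_cubic_one_degree_two:
  assumes fin: "finite V" and bl: "block E V" and ex: "excess E V = 8" and x: "x \<in> V"
    and Nx: "nbh E V x = {w, p, q}" "w \<noteq> p" "w \<noteq> q" "p \<noteq> q"
    and Nw: "nbh E V w = {x, y}" "y \<noteq> x"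
    and deg: "card (nbh E V p) = 3" "card (nbh E V q) = 3"
  shows "ramsey_bounded E 3 V"
proof -
  have V: "w \<in> V" "p \<in> V" "q \<in> V" "y \<in> V"
    and ne: "w \<noteq> x" "p \<noteq> x" "q \<noteq> x" "y \<noteq> w"
    using nbhE[OF Nx(1), of w] nbhE[OF Nx(1), of p] nbhE[OF Nx(1), of q] nbhE[OF Nw(1), of y] by simp_all
  have sp: "sparse E 4 (V - {t})" if "t \<in> V" "card (nbh E V t) = 3" for t
    by (rule sparse_le[OF block_remove_sparse[OF bl fin that(1)]]) (use that ex in simp)
  \<comment> \<open>A set of excess 4 avoiding \<open>x\<close> and its neighbours would be attached by a single edge.\<close>
  have avoid: "excess E S < 4" if S: "S \<subseteq> V - {x, w, p, q}" for S
  proof (rule ccontr)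
    assume "\<not> excess E S < 4"
    then have e4: "4 \<le> excess E S" by simp
    have finS: "finite S" by (rule finite_subset[OF S]) (use fin in simp)
    have SV: "S \<subseteq> V" using S by auto
    let ?d = "\<lambda>v. int (card (nbh E V v)) - 2"
    have nonneg: "0 \<le> ?d v" if "v \<in> V" for v using block_degree[OF bl that] by simp
    have "sum ?d (S \<union> {x, p, q}) \<le> sum ?d V"
      using nonneg V x SV fin by (intro sum_mono2) auto
    moreover have "sum ?d (S \<union> {x, p, q}) = sum ?d S + sum ?d {x, p, q}"
      using finS S by (intro sum.union_disjoint) auto
    moreover have "sum ?d {x, p, q} = 3" using Nx deg ne by simp
    moreover have "sum ?d V = 8" using ex by (simp add: excess_def)
    ultimately have "sum ?d S \<le> 5" by simp
    \<comment> \<open>The vertices \<open>x\<close>, \<open>p\<close> and \<open>q\<close>, of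
      degree 3, take 3 of the total 8, so the degree surplus on \<open>S\<close> is at most 5. As 4
      of it is the excess of \<open>S\<close>, at most one edge leaves \<open>S\<close>.\<close>
    then have le1: "(\<Sum>v\<in>S. int (card (nbh E V v)) - int (card (nbh E S v))) \<le> 1"
      using e4 by (simp add: excess_def sum_subtractf)
    have sub: "nbh E S v \<subseteq> nbh E V v" for v using SV by (auto simp: nbh_def)
    have le: "card (nbh E S v) \<le> card (nbh E V v)" for v
      by (rule card_mono[OF finite_nbh[OF fin] sub])
    \<comment> \<open>\<open>s\<close> is the end in \<open>S\<close> of the only leaving edge, or
      any vertex of \<open>S\<close> if there is none; it contradicts
      \<open>block_cut\<close>.\<close>
    obtain s where s: "s \<in> S" "\<And>v. v \<in> S - {s} \<Longrightarrow> card (nbh E S v) = card (nbh E V v)"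
    proof (cases "\<exists>s\<in>S. card (nbh E S s) \<noteq> card (nbh E V s)")
      case True
      then obtain s where s: "s \<in> S" "card (nbh E S s) \<noteq> card (nbh E V s)" by blast
      have "card (nbh E S v) = card (nbh E V v)" if v: "v \<in> S - {s}" for v
      proof (rule ccontr)
        assume "card (nbh E S v) \<noteq> card (nbh E V v)"
        then have "2 \<le> (\<Sum>u\<in>{s, v}. int (card (nbh E V u)) - int (card (nbh E S u)))"
        proof -
          have "s \<noteq> v" using v by blast
          then show ?thesis using s le[of s] le[of v] \<open>card (nbh E S v) \<noteq> card (nbh E V v)\<close> by simp
        qed
        also have "\<dots> \<le> (\<Sum>u\<in>S. int (card (nbh E V u)) - int (card (nbh E S u)))"
          using finS s v le by (intro sum_mono2) auto
        finally show False using le1 by simp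
      qed
      then show ?thesis using that s by blast
    next
      case False
      moreover have "S \<noteq> {}" using e4 by auto
      ultimately show ?thesis using that by blast
    qed
    have "S \<noteq> V" "S \<noteq> {s}" using S x excess_ge_4_card[OF finS e4] by auto
    from block_cut[OF bl SV s(1) this] obtain u v where uv: "u \<in> S - {s}" "v \<in> V - S" "E u v" .
    have "nbh E S u = nbh E V u" by (rule card_subset_eq[OF finite_nbh[OF fin] sub s(2)[OF uv(1)]])
    then show False using uv by (auto simp: nbh_def)
  qed
  \<comment> \<open>If \<open>w\<close> is also adjacent to \<open>p\<close>, then a set of excess 4 can absorb \<open>x\<close> and \<open>w\<close>.\<close>
  have tri: "sparse E 2 (V - {w} - {q', x})"
    if Nx': "nbh E V x = {w, p', q'}" "p' \<noteq> q'" "w \<noteq> q'" and dq: "card (nbh E V q') = 3" and y: "y = p'" for p' q'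
  proof (rule ccontr)
    assume "\<not> ?thesis"
    then obtain S where S: "S \<subseteq> V - {w} - {q', x}" "S \<noteq> {}" "4 \<le> excess E S"
      using not_sparse_quadratic[of "V - {w} - {q', x}"] fin by blast
    have finS: "finite S" by (rule finite_subset[OF S(1)]) (use fin in simp)
    have "w \<notin> {p', q'}" using y ne(4) that(3) by auto
    then have "{p', q'} = nbh E V x - {w}" unfolding Nx'(1) by blast
    also have "\<dots> = {p, q}" unfolding Nx(1) using Nx(2,3) by blast
    finally have pq: "{p', q'} = {p, q}" .
    have "p' \<in> S"
    proof (rule ccontr)
      assume "p' \<notin> S"
      then have "S \<subseteq> V - {x, w} - {p', q'}" using S(1) by blast
      also have "\<dots> = V - {x, w, p, q}" unfolding pq by blast
      finally show False using avoid[of S] S(3) by simp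
    qed
    have q: "q' \<in> V" "q' \<noteq> x" using nbhE[OF Nx'(1), of q'] by auto
    have "nbh E S x = {p'}"
      using S(1) \<open>p' \<in> S\<close> nbhD[OF Nx'(1)] nbhE[OF Nx'(1), of p'] by (auto simp: nbh_def)
    moreover have "nbh E (insert x S) w = {x, p'}"
      using S(1) \<open>p' \<in> S\<close> nbhD[OF Nw(1)] nbhE[OF Nw(1)] y by (auto simp: nbh_def)
    moreover have "x \<noteq> p'" using Nw y by auto
    moreover have "x \<notin> S" "w \<notin> insert x S" using S(1) ne by auto
    \<comment> \<open>\<open>x\<close> brings one edge and changes nothing, then \<open>w\<close>
      brings two edges and adds 2; but \<open>V - {q'}\<close> allows excess 4 at most.\<close>
    ultimately have "6 \<le> excess E (insert w (insert x S))"
      using excess_insert[OF finS, of x] excess_insert[of "insert x S" w] finS S(3) by simp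
    moreover have "insert w (insert x S) \<subseteq> V - {q'}" using S(1) V x q that(3) by auto
    ultimately show False using sparseD[OF sp[OF q(1) dq], of "insert w (insert x S)"] by simp
  qed
  have "\<exists>v z. {v, z} = {p, q} \<and> v \<noteq> z \<and> v \<noteq> y \<and> sparse E 2 (V - {w} - {v, x})"
  proof -
    consider "y = p" | "y = q" | "y \<noteq> p" "y \<noteq> q" by blast
    then show ?thesis
    proof cases
      case 1
      then show ?thesis using tri[of p q] Nx deg by (intro exI[of _ q] exI[of _ p]) auto
    next
      case 2
      then show ?thesis using tri[of q p] Nx deg by (intro exI[of _ p] exI[of _ q]) auto
    next
      case 3
      \<comment> \<open>Offending sets for both choices have a union inside \<open>V - {x}\<close>,
        of excess at most 4. So their intersection has excess at least 4, yet it misses both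
        \<open>p\<close> and \<open>q\<close>, against \<open>avoid\<close>.\<close>
      have "sparse E 2 (V - {w} - {p, x}) \<or> sparse E 2 (V - {w} - {q, x})"
      proof (rule ccontr)
        assume *: "\<not> ?thesis"
        obtain S where S: "S \<subseteq> V - {w} - {p, x}" "S \<noteq> {}" "4 \<le> excess E S"
          using not_sparse_quadratic[of "V - {w} - {p, x}"] fin * by blast
        obtain T where T: "T \<subseteq> V - {w} - {q, x}" "T \<noteq> {}" "4 \<le> excess E T"
          using not_sparse_quadratic[of "V - {w} - {q, x}"] fin * by blast
        have finS: "finite S" by (rule finite_subset[OF S(1)]) (use fin in simp)
        have finT: "finite T" by (rule finite_subset[OF T(1)]) (use fin in simp)
        have "card (nbh E V x) = 3" using Nx by simp
        have "excess E (S \<union> T) \<le> 4"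
          by (rule sparseD[OF sp[OF x \<open>card (nbh E V x) = 3\<close>]]) (use S(1) T(1,2) in auto)
        then have "4 \<le> excess E (S \<inter> T)" using excess_supermodular[OF finS finT] S(3) T(3) by linarith
        moreover have "S \<inter> T \<subseteq> V - {x, w, p, q}" using S(1) T(1) by blast
        ultimately show False using avoid[of "S \<inter> T"] by simp
      qed
      then show ?thesis using 3 Nx(4) by (metis insert_commute)
    qed
  qed
  then obtain v z where vz: "{v, z} = {p, q}" "v \<noteq> z" "v \<noteq> y" and spv: "sparse E 2 (V - {w} - {v, x})" by blast
  have v: "v \<in> V" "v \<noteq> x" "v \<noteq> w" "z \<in> V" "z \<noteq> x" "z \<noteq> w" "nbh E V x = {w, v, z}"
    using vz(1,2) V ne Nx by (auto simp: doubleton_eq_iff)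
  have rb: "ramsey_bounded E 2 (V - {w} - {v, x})" using fin spv by (intro ramsey_bounded_quadratic) auto
  have "ramsey_bounded E (Suc 2) V"
  proof (rule ramsey_bounded_subdivided_star_leaf[OF sgraph_axioms fin v(1) x v(2) _ _ _ _ _ rb])
    show "z \<in> V - {w} - {v, x}" using v vz(2) by auto
    show "u \<in> insert v (insert z {w})" if "u \<in> V" "E x u" for u
      using nbhD[OF v(7) that] by auto
    show "\<exists>y\<in>V - {w} - {v, x}. \<forall>u\<in>V. E w' u \<longrightarrow> u = x \<or> u = y" if "w' \<in> {w}" for w'
    proof -
      have "y \<in> V - {w} - {v, x}" using V ne Nw vz(3) by auto
      then show ?thesis using that nbhD[OF Nw(1)] by blast
    qed
  qed (use V v ne in auto)
  then show ?thesis by (simp add: numeral_3_eq_3 numeral_2_eq_2)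
qed

lemma card_2_containing:
  assumes "card N = 2" "a \<in> N"
  obtains b where "N = {a, b}" "b \<noteq> a"
  using assms by (auto simp: card_2_iff)

lemma card_3_containing:
  assumes "card N = 3" "a \<in> N"
  obtains b c where "N = {a, b, c}" "b \<noteq> a" "c \<noteq> a" "b \<noteq> c"
proof -
  have "card (N - {a}) = 2" using assms by (simp add: card_Diff_singleton)
  then obtain b c where bc: "N - {a} = {b, c}" "b \<noteq> c" by (auto simp: card_2_iff)
  then have "N = {a, b, c}" "b \<noteq> a" "c \<noteq> a" using assms(2) by auto
  then show ?thesis using that bc by blast
qed

text \<open>Both degrees occur, so connectedness gives adjacent \<open>w\<close> of degree 2 and
  \<open>x\<close> of degree 3. The cases depend on whether \<open>x\<close> has a second neighbour
  of degree 2.\<close>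

lemma ramsey_bounded_cubic_subdivided:
  assumes fin: "finite V" and bl: "block E V" and ex: "excess E V = 8"
    and deg: "\<And>v. v \<in> V \<Longrightarrow> card (nbh E V v) = 2 \<or> card (nbh E V v) = 3"
    and two: "\<exists>v\<in>V. card (nbh E V v) = 2"
  shows "ramsey_bounded E 3 V"
proof -
  let ?D = "{v \<in> V. card (nbh E V v) = 2}"
  have "0 < excess E V" using ex by simp
  then obtain u where "u \<in> V" "3 \<le> card (nbh E V u)" by (rule excess_pos_degree)
  then have "u \<in> V - ?D" by simp
  then have "?D \<noteq> V" by blast
  moreover have "?D \<subseteq> V" by blast
  moreover have "?D \<noteq> {}" using two by auto
  ultimately have "\<exists>w\<in>?D. \<exists>x\<in>V - ?D. E w x"
    using block_connected[OF bl, unfolded connected_in_def, rule_format, of ?D] by simp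
  then obtain w x where wx: "w \<in> ?D" "x \<in> V - ?D" "E w x" by blast
  then have V: "w \<in> V" "x \<in> V" "card (nbh E V w) = 2" "card (nbh E V x) = 3" "x \<in> nbh E V w" "w \<in> nbh E V x"
    using deg[of x] sym by (auto simp: nbh_def)
  obtain y where y: "nbh E V w = {x, y}" "y \<noteq> x" using card_2_containing[OF V(3,5)] .
  obtain p q where pq: "nbh E V x = {w, p, q}" "p \<noteq> w" "q \<noteq> w" "p \<noteq> q"
    using card_3_containing[OF V(4,6)] .
  have pqV: "p \<in> V" "q \<in> V" "x \<in> nbh E V p" "x \<in> nbh E V q"
    using nbhE[OF pq(1), of p] nbhE[OF pq(1), of q] V by (auto simp: nbh_def)
  consider "card (nbh E V p) = 2" | "card (nbh E V q) = 2" | "card (nbh E V p) = 3" "card (nbh E V q) = 3"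
    using deg pqV by blast
  then show ?thesis
  proof cases
    case 1
    obtain y' where "nbh E V p = {x, y'}" "y' \<noteq> x" using card_2_containing[OF 1 pqV(3)] .
    then show ?thesis
      using ramsey_bounded_cubic_two_degree_two[OF fin bl ex V(2) pq(1) _ _ pq(4) y] pq by simp
  next
    case 2
    obtain y' where y': "nbh E V q = {x, y'}" "y' \<noteq> x" using card_2_containing[OF 2 pqV(4)] .
    have "nbh E V x = {w, q, p}" using pq(1) by auto
    from ramsey_bounded_cubic_two_degree_two[OF fin bl ex V(2) this _ _ _ y y'] show ?thesis using pq by simp
  next
    case 3
    then show ?thesis
      using ramsey_bounded_cubic_one_degree_two[OF fin bl ex V(2) pq(1) _ _ pq(4) y] pq by simp
  qed
qed

section \<open>Cubic graphs on 8 vertices\<close>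

text \<open>Three vertices without a triangle form a forest: one vertex of a nonadjacent pair can be
  added last, as a leaf.\<close>

lemma ramsey_bounded_three:
  assumes "\<not> (E a b \<and> E b c \<and> E a c)"
  shows "ramsey_bounded E 1 {a, b, c}"
proof -
  have one: "ramsey_bounded E 1 {c}" for c
    by (rule ramsey_bounded_leaf[OF sgraph_axioms ramsey_bounded_empty]) auto
  have two: "ramsey_bounded E 1 {b, c}" for b c
    by (rule ramsey_bounded_leaf[OF sgraph_axioms one]) auto
  have three: "ramsey_bounded E 1 {a, b, c}" if "\<not> E a b" for a b c
    by (rule ramsey_bounded_leaf[OF sgraph_axioms two]) (use that in auto)
  consider "\<not> E a b" | "\<not> E b c" | "\<not> E a c" using assms by blast
  then show ?thesis
  proof cases
    case 1
    then show ?thesis by (rule three)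
  next
    case 2
    have "{a, b, c} = {b, c, a}" by auto
    then show ?thesis using three[OF 2, of a] by simp
  next
    case 3
    have "{a, b, c} = {a, c, b}" by auto
    then show ?thesis using three[OF 3, of b] by simp
  qed
qed

text \<open>There is a 4-cycle \<open>v\<close>, \<open>w\<close>, \<open>x\<close>,
  \<open>w'\<close>. After deleting \<open>v\<close>, both \<open>w\<close> and \<open>w'\<close>
  have degree 2 and hang on \<open>x\<close>, whose third neighbour is \<open>b\<close>; removing
  \<open>b\<close>, \<open>x\<close>, \<open>w\<close> and \<open>w'\<close> together leaves three
  vertices, a forest since there are no triangles.\<close>

lemma ramsey_bounded_cubic_triangle_free:
  assumes fin: "finite V" and deg: "\<And>v. v \<in> V \<Longrightarrow> card (nbh E V v) = 3" and card: "card V = 8"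
    and tf: "\<And>a b c. a \<in> V \<Longrightarrow> b \<in> V \<Longrightarrow> c \<in> V \<Longrightarrow> E a b \<Longrightarrow> E b c \<Longrightarrow> \<not> E a c"
  shows "ramsey_bounded E 3 V"
proof -
  obtain v where v: "v \<in> V" using card by fastforce
  let ?N = "nbh E V v"
  have NV: "w \<in> V \<and> E v w \<and> E w v \<and> w \<noteq> v" if "w \<in> ?N" for w using nbhE[OF refl that] .
  have finN: "finite ?N" using fin by (rule finite_nbh)
  \<comment> \<open>The second neighbourhood of \<open>v\<close> has at most 4 vertices and receives 6 edges.\<close>
  have "\<exists>w\<in>?N. \<exists>w'\<in>?N. w \<noteq> w' \<and> (nbh E V w - {v}) \<inter> (nbh E V w' - {v}) \<noteq> {}"
  proof (rule ccontr)
    assume "\<not> ?thesis"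
    then have disj: "\<forall>w\<in>?N. \<forall>w'\<in>?N. w \<noteq> w' \<longrightarrow> (nbh E V w - {v}) \<inter> (nbh E V w' - {v}) = {}" by blast
    have c2: "card (nbh E V w - {v}) = 2" if "w \<in> ?N" for w
    proof -
      have "v \<in> nbh E V w" using NV[OF that] v by (simp add: nbh_def)
      then show ?thesis using deg[of w] NV[OF that] by (simp add: card_Diff_singleton)
    qed
    have "card (\<Union>w\<in>?N. nbh E V w - {v}) = (\<Sum>w\<in>?N. card (nbh E V w - {v}))"
      by (rule card_UN_disjoint[OF finN _ disj]) (simp add: finite_nbh[OF fin])
    also have "\<dots> = 6" using c2 deg[OF v] by simp
    finally have "card (\<Union>w\<in>?N. nbh E V w - {v}) = 6" .
    moreover have "(\<Union>w\<in>?N. nbh E V w - {v}) \<subseteq> V - insert v ?N"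
    proof
      fix x assume "x \<in> (\<Union>w\<in>?N. nbh E V w - {v})"
      then obtain w where w: "w \<in> ?N" "x \<in> nbh E V w" "x \<noteq> v" by blast
      then have "x \<in> V" "E w x" by (auto simp: nbh_def)
      then have "\<not> E v x" using tf[of v w x] NV[OF w(1)] v by blast
      then show "x \<in> V - insert v ?N" using \<open>x \<in> V\<close> w(3) by (simp add: nbh_def)
    qed
    then have "card (\<Union>w\<in>?N. nbh E V w - {v}) \<le> card (V - insert v ?N)"
      using fin by (intro card_mono) auto
    moreover have "card (insert v ?N) = 4" using finN deg[OF v] irrefl by (simp add: nbh_def)
    then have "card (V - insert v ?N) = 4"
      using card finN v nbh_subset[of E V v] by (subst card_Diff_subset) auto
    ultimately show False by simp
  qed
  then obtain w w' x where w: "w \<in> ?N" "w' \<in> ?N" "w \<noteq> w'" "x \<in> nbh E V w" "x \<in> nbh E V w'" "x \<noteq> v" by blast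
  have xV: "x \<in> V" "E w x" "E x w" "E w' x" "E x w'" "x \<noteq> w" "x \<noteq> w'"
    using nbhE[OF refl w(4)] nbhE[OF refl w(5)] by auto
  have wV: "w \<in> V" "E v w" "E w v" "w \<noteq> v" "w' \<in> V" "E v w'" "E w' v" "w' \<noteq> v"
    using NV[OF w(1)] NV[OF w(2)] by auto
  have "w \<in> nbh E V x" using wV xV by (simp add: nbh_def)
  from card_3_containing[OF deg[OF xV(1)] this]
  obtain b0 c0 where b0: "nbh E V x = {w, b0, c0}" "b0 \<noteq> w" "c0 \<noteq> w" "b0 \<noteq> c0" .
  have "w' \<in> nbh E V x" using wV xV by (simp add: nbh_def)
  then have "w' = b0 \<or> w' = c0" using b0(1) w(3) by auto
  then have "\<exists>b. nbh E V x = {w, w', b} \<and> b \<noteq> w \<and> b \<noteq> w'"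
  proof
    assume "w' = b0"
    then show ?thesis using b0 by (intro exI[of _ c0]) auto
  next
    assume "w' = c0"
    then show ?thesis using b0 by (intro exI[of _ b0]) auto
  qed
  then obtain b where Nx: "nbh E V x = {w, w', b}" "b \<noteq> w" "b \<noteq> w'" by blast
  have bV: "b \<in> V" "E x b" "E b x" "b \<noteq> x" using nbhE[OF Nx(1), of b] by auto
  have "\<not> E v x" by (rule tf[OF v wV(1) xV(1) wV(2) xV(2)])
  then have bv: "b \<noteq> v" using bV by auto
  have third: "\<exists>c. nbh E V u = {v, x, c} \<and> c \<noteq> x \<and> c \<noteq> v" if u: "u \<in> {w, w'}" for u
  proof -
    have uV: "u \<in> V" "v \<in> nbh E V u" "x \<in> nbh E V u" using u wV xV v by (auto simp: nbh_def)
    from card_3_containing[OF deg[OF uV(1)] uV(2)]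
    obtain c d where c: "nbh E V u = {v, c, d}" "c \<noteq> v" "d \<noteq> v" "c \<noteq> d" .
    then have "x = c \<or> x = d" using uV(3) w(6) by auto
    then show ?thesis
    proof
      assume "x = c"
      then show ?thesis using c by (intro exI[of _ d]) auto
    next
      assume "x = d"
      then show ?thesis using c by (intro exI[of _ c]) auto
    qed
  qed
  have "V - {v} - {w, w'} - {b, x} = V - {v, w, w', b, x}" by auto
  moreover have "card (V - {v, w, w', b, x}) = 3"
    using card fin v wV xV bV w Nx bv by (subst card_Diff_subset) (auto simp: card_insert_if)
  ultimately obtain r s t where rst: "V - {v} - {w, w'} - {b, x} = {r, s, t}" "r \<noteq> s" "s \<noteq> t" "r \<noteq> t"
    by (auto simp: card_3_iff)
  have "ramsey_bounded E 1 {r, s, t}"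
  proof (rule ramsey_bounded_three)
    have "r \<in> V" "s \<in> V" "t \<in> V" using rst(1) by auto
    then show "\<not> (E r s \<and> E s t \<and> E r t)" using tf by blast
  qed
  then have rb: "ramsey_bounded E 1 (V - {v} - {w, w'} - {b, x})" using rst(1) by simp
  \<comment> \<open>In the star lemma \<open>b\<close> takes the role of \<open>v\<close>, with
    \<open>I = {w, w'}\<close>; the cycle vertex \<open>v\<close> is restored afterwards as an
    apex.\<close>
  have "ramsey_bounded E (Suc 1) (V - {v})"
  proof (rule ramsey_bounded_subdivided_star[OF sgraph_axioms _ _ _ bV(4) _ _ _ _ rb])
    show "u \<in> insert b {w, w'}" if "u \<in> V - {v}" "E x u" for u
      using nbhD[OF Nx(1), of u] that by auto
    show "\<exists>y\<in>V - {v} - {w, w'} - {b, x}. \<forall>z\<in>V - {v}. E u z \<longrightarrow> z = x \<or> z = y"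
      if u: "u \<in> {w, w'}" for u
    proof -
      obtain c where c: "nbh E V u = {v, x, c}" "c \<noteq> x" "c \<noteq> v" using third[OF u] by blast
      have cV: "c \<in> V" "E u c" "E c u" "c \<noteq> u" using nbhE[OF c(1), of c] by auto
      have "\<not> E w w'" "\<not> E w' w" using tf[OF v wV(1,5,2)] wV sym by blast+
      moreover have "\<not> E u b"
        using tf[of x u b] u xV wV bV by blast
      ultimately have "c \<in> V - {v} - {w, w'} - {b, x}" using c cV u by auto
      moreover have "z = x \<or> z = c" if "z \<in> V - {v}" "E u z" for z
        using nbhD[OF c(1), of z] that by auto
      ultimately show ?thesis by blast
    qed
  qed (use fin bV bv xV wV w Nx in auto)
  then have "ramsey_bounded E (Suc (Suc 1)) V" by (rule ramsey_bounded_apex[OF sgraph_axioms _ v])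
  then show ?thesis by (simp add: numeral_3_eq_3)
qed

text \<open>\<open>a\<close>, \<open>d\<close>, \<open>e\<close>, \<open>f\<close> span K_4 minus
  the edge \<open>ef\<close>: with that edge they would be a component. The outer neighbours
  \<open>e'\<close> and \<open>f'\<close> differ, since a common one would be a cut vertex. Degrees
  then determine the whole graph.\<close>

lemma ramsey_bounded_cubic_diamond:
  assumes fin: "finite V" and bl: "block E V" and deg: "\<And>v. v \<in> V \<Longrightarrow> card (nbh E V v) = 3" and card: "card V = 8"
    and a: "a \<in> V" "nbh E V a = {d, e, f}" "d \<noteq> e" "d \<noteq> f" "e \<noteq> f" "E d e" "E d f"
  shows "ramsey_bounded E 3 V"
proof -
  have V: "d \<in> V" "e \<in> V" "f \<in> V" and ne: "d \<noteq> a" "e \<noteq> a" "f \<noteq> a"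
    and adj: "E a d" "E d a" "E a e" "E e a" "E a f" "E f a" "E e d" "E f d"
    using nbhE[OF a(2), of d] nbhE[OF a(2), of e] nbhE[OF a(2), of f] sym[OF a(6)] sym[OF a(7)] by simp_all
  have Nd: "nbh E V d = {a, e, f}"
  proof (rule card_subset_eq[symmetric, OF finite_nbh[OF fin]])
    show "{a, e, f} \<subseteq> nbh E V d" using a V adj by (simp add: nbh_def)
    show "card {a, e, f} = card (nbh E V d)" using deg[OF V(1)] ne a by simp
  qed
  have third: "\<exists>u'. nbh E V u = {a, d, u'} \<and> u' \<noteq> a \<and> u' \<noteq> d" if "u \<in> V" "E u a" "E u d" for u
  proof -
    have u: "a \<in> nbh E V u" "d \<in> nbh E V u" using that a V by (auto simp: nbh_def)
    have "card (nbh E V u) = 3" by (rule deg[OF that(1)])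
    from card_3_containing[OF this u(1)]
    obtain c c' where c: "nbh E V u = {a, c, c'}" "c \<noteq> a" "c' \<noteq> a" "c \<noteq> c'" .
    then have "d = c \<or> d = c'" using u(2) ne by auto
    then show ?thesis
    proof
      assume "d = c"
      then show ?thesis using c by (intro exI[of _ c']) auto
    next
      assume "d = c'"
      then show ?thesis using c by (intro exI[of _ c]) auto
    qed
  qed
  obtain e' where Ne: "nbh E V e = {a, d, e'}" "e' \<noteq> a" "e' \<noteq> d" using third[OF V(2) adj(4,7)] by blast
  obtain f' where Nf: "nbh E V f = {a, d, f'}" "f' \<noteq> a" "f' \<noteq> d" using third[OF V(3) adj(6,8)] by blast
  have V': "e' \<in> V" "E e e'" "E e' e" "e' \<noteq> e" "f' \<in> V" "E f f'" "E f' f" "f' \<noteq> f"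
    using nbhE[OF Ne(1), of e'] nbhE[OF Nf(1), of f'] by simp_all
  have four: "card {a, d, e, f} = 4" using a ne by simp
  have ef: "\<not> E e f"
  proof
    assume ef: "E e f"
    have "f = e'" "e = f'" using nbhD[OF Ne(1) V(3) ef] nbhD[OF Nf(1) V(2) sym[OF ef]] ne a by auto
    have "{a, d, e, f} \<subseteq> V" "{a, d, e, f} \<noteq> {}" "{a, d, e, f} \<noteq> V" using a V four card by auto
    then have "\<exists>u\<in>{a, d, e, f}. \<exists>v\<in>V - {a, d, e, f}. E u v"
      using block_connected[OF bl, unfolded connected_in_def, rule_format, of "{a, d, e, f}"] by simp
    then obtain u v where "u \<in> {a, d, e, f}" "v \<in> V" "v \<notin> {a, d, e, f}" "E u v" by blast
    then show False
      using nbhD[OF a(2), of v] nbhD[OF Nd, of v] nbhD[OF Ne(1), of v] nbhD[OF Nf(1), of v]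
        \<open>f = e'\<close> \<open>e = f'\<close> by auto
  qed
  have e'f: "e' \<noteq> f" "f' \<noteq> e" using ef V' sym by auto
  have e'f': "e' \<noteq> f'"
  proof
    assume eq: "e' = f'"
    let ?S = "{a, d, e, f, e'}"
    have c5: "card ?S = 5" using a ne Ne V' e'f by simp
    have "card ?S \<noteq> card V" "card ?S \<noteq> card {e'}" using c5 card by simp_all
    then have S': "?S \<noteq> V" "?S \<noteq> {e'}" by metis+
    have S: "?S \<subseteq> V" "e' \<in> ?S" using a(1) V V'(1) by simp_all
    obtain u v where "u \<in> ?S - {e'}" "v \<in> V - ?S" "E u v" by (rule block_cut[OF bl S S'])
    then show False
      using nbhD[OF a(2), of v] nbhD[OF Nd, of v] nbhD[OF Ne(1), of v] nbhD[OF Nf(1), of v] eq by auto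
  qed
  let ?S = "{a, d, e, f, e', f'}"
  have "card ?S = 6" using a ne Ne Nf V' e'f e'f' by simp
  then have "card (V - ?S) = 2" using card fin a V V' by (subst card_Diff_subset) auto
  then obtain r s where rs: "V - ?S = {r, s}" "r \<noteq> s" by (auto simp: card_2_iff)
  have "?S \<subseteq> V" using a(1) V V'(1,5) by simp
  then have "V = ?S \<union> (V - ?S)" by blast
  then have V_eq: "V = {a, d, e, f, e', f', r, s}" unfolding rs(1) by auto
  have rsV: "r \<in> V" "s \<in> V" "r \<notin> ?S" "s \<notin> ?S" using rs by auto
  \<comment> \<open>The vertices \<open>a\<close>, \<open>d\<close>, \<open>e\<close>,
    \<open>f\<close> have no room for \<open>r\<close> or \<open>s\<close>, so each of these two is
    adjacent to \<open>e'\<close>, \<open>f'\<close> and the other.\<close>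
  have N: "nbh E V u = {e', f', t}" if u: "u \<in> V" "u \<notin> ?S" and t: "{r, s} = {u, t}" "u \<noteq> t" for u t
  proof (rule card_subset_eq)
    show "nbh E V u \<subseteq> {e', f', t}"
    proof
      fix z assume "z \<in> nbh E V u"
      then have z: "z \<in> V" "E u z" "E z u" "z \<noteq> u" using nbhE[OF refl, of z V u] by auto
      then have "z \<notin> {a, d, e, f}"
        using u nbhD[OF a(2), of u] nbhD[OF Nd, of u] nbhD[OF Ne(1), of u] nbhD[OF Nf(1), of u] by auto
      moreover have "z \<in> ?S \<union> {u, t}" using z(1) t V_eq by auto
      ultimately show "z \<in> {e', f', t}" using z by auto
    qed
    have "t \<noteq> e'" "t \<noteq> f'" "e' \<noteq> t" "f' \<noteq> t" using t rsV by (auto simp: doubleton_eq_iff)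
    then show "card (nbh E V u) = card {e', f', t}" using deg[OF u(1)] e'f' by simp
  qed simp
  have Nr: "nbh E V r = {e', f', s}" by (rule N) (use rsV rs in auto)
  have Ns: "nbh E V s = {e', f', r}" by (rule N) (use rsV rs in auto)
  have "nbh E V e' = {e, r, s}"
  proof (rule card_subset_eq[symmetric, OF finite_nbh[OF fin]])
    show "{e, r, s} \<subseteq> nbh E V e'"
      using V V' rsV nbhE[OF Nr, of e'] nbhE[OF Ns, of e'] by (simp add: nbh_def)
    show "card {e, r, s} = card (nbh E V e')" using deg[OF V'(1)] rs(2) rsV by auto
  qed
  then have e'f'_adj: "\<not> E e' f'" using nbhD[of V e' _ f'] V' e'f rsV by auto
  have "V - {a} - {e, f} - {r, d} = {e', f', s}"
    using V_eq a ne Ne Nf V' e'f e'f' rsV rs(2) by auto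
  moreover have "ramsey_bounded E 1 {e', f', s}" by (rule ramsey_bounded_three) (use e'f'_adj in blast)
  ultimately have rb: "ramsey_bounded E 1 (V - {a} - {e, f} - {r, d})" by simp
  \<comment> \<open>After deleting \<open>a\<close>, the centre \<open>d\<close> has only the
    neighbours \<open>e\<close> and \<open>f\<close>. The role of \<open>v\<close> is free and goes
    to \<open>r\<close>: this breaks the cycles through \<open>r\<close> and \<open>s\<close> and
    leaves the path \<open>e'\<close>, \<open>s\<close>, \<open>f'\<close>.\<close>
  have "ramsey_bounded E (Suc 1) (V - {a})"
  proof (rule ramsey_bounded_subdivided_star[OF sgraph_axioms _ _ _ _ _ _ _ _ rb])
    show "u \<in> insert r {e, f}" if "u \<in> V - {a}" "E d u" for u
      using nbhD[OF Nd, of u] that by auto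
    show "\<exists>y\<in>V - {a} - {e, f} - {r, d}. \<forall>z\<in>V - {a}. E u z \<longrightarrow> z = d \<or> z = y" if u: "u \<in> {e, f}" for u
    proof -
      have "e' \<in> V - {a} - {e, f} - {r, d}" "f' \<in> V - {a} - {e, f} - {r, d}"
        using V' Ne Nf e'f rsV by auto
      moreover have "z = d \<or> z = e'" if "z \<in> V - {a}" "E e z" for z using nbhD[OF Ne(1), of z] that by auto
      moreover have "z = d \<or> z = f'" if "z \<in> V - {a}" "E f z" for z using nbhD[OF Nf(1), of z] that by auto
      ultimately show ?thesis using u by blast
    qed
    show "finite (V - {a})" using fin by simp
    show "r \<in> V - {a}" "d \<in> V - {a}" "r \<noteq> d" using rsV V ne by auto
    show "{e, f} \<subseteq> V - {a} - {r, d}" using V ne a rsV by auto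
  qed simp
  then have "ramsey_bounded E (Suc (Suc 1)) V" by (rule ramsey_bounded_apex[OF sgraph_axioms _ a(1)])
  then show ?thesis by (simp add: numeral_3_eq_3)
qed

text \<open>Delete \<open>a'\<close>. Then \<open>a\<close> has only the adjacent neighbours
  \<open>b\<close> and \<open>c\<close> and is placed last, in a triangle on the image of
  \<open>bc\<close>, while \<open>b'\<close> goes to the centre of the neighbourhood. What remains
  is \<open>c'\<close>, \<open>r\<close>, \<open>s\<close> with the path from \<open>c\<close> to
  \<open>b\<close> hanging on \<open>c'\<close>.\<close>

lemma ramsey_bounded_cubic_triangle_aux:
  assumes fin: "finite V" and V: "V = {a, b, c, a', b', c', r, s}" "distinct [a, b, c, a', b', c', r, s]"
    and Na: "nbh E V a = {b, c, a'}" and Nb: "nbh E V b = {a, c, b'}" and Nc: "nbh E V c = {a, b, c'}"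
    and rs: "\<not> (E c' r \<and> E r s \<and> E c' s)"
  shows "ramsey_bounded E 3 V"
proof -
  have "ramsey_bounded E 1 {c', r, s}" using rs by (rule ramsey_bounded_three)
  then have "ramsey_bounded E 1 (insert c {c', r, s})"
  proof (rule ramsey_bounded_leaf[OF sgraph_axioms])
    show "u = u'" if "u \<in> {c', r, s}" "u' \<in> {c', r, s}" "E c u" "E c u'" for u u'
      using nbhD[OF Nc, of u] nbhD[OF Nc, of u'] that V by auto
  qed auto
  then have "ramsey_bounded E 1 (insert b (insert c {c', r, s}))"
  proof (rule ramsey_bounded_leaf[OF sgraph_axioms])
    show "u = u'" if "u \<in> insert c {c', r, s}" "u' \<in> insert c {c', r, s}" "E b u" "E b u'" for u u'
      using nbhD[OF Nb, of u] nbhD[OF Nb, of u'] that V by auto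
  qed auto
  moreover have "V - {a'} - {a} - {b'} = insert b (insert c {c', r, s})" using V by auto
  ultimately have rb: "ramsey_bounded E 1 (V - {a'} - {a} - {b'})" by simp
  have "ramsey_bounded E (Suc 1) (V - {a'})"
  proof (rule ramsey_bounded_triangles[OF sgraph_axioms _ _ _ _ _ rb])
    show "\<exists>u\<in>V - {a'} - {a} - {b'}. \<exists>v\<in>V - {a'} - {a} - {b'}. E u v \<and> (\<forall>z\<in>V - {a'}. E w z \<longrightarrow> z = u \<or> z = v)"
      if "w \<in> {a}" for w
    proof -
      have "b \<in> V - {a'} - {a} - {b'}" "c \<in> V - {a'} - {a} - {b'}" using V by auto
      moreover have "E b c" using nbhE[OF Nb, of c] by simp
      moreover have "z = b \<or> z = c" if "z \<in> V - {a'}" "E a z" for z using nbhD[OF Na, of z] that by auto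
      ultimately show ?thesis using \<open>w \<in> {a}\<close> by blast
    qed
  qed (use fin V in auto)
  moreover have "a' \<in> V" using V by simp
  ultimately have "ramsey_bounded E (Suc (Suc 1)) V" using ramsey_bounded_apex[OF sgraph_axioms] by blast
  then show ?thesis by (simp add: numeral_3_eq_3)
qed

text \<open>Without a diamond the three outer neighbours of the triangle are distinct, which leaves
  two vertices \<open>r\<close> and \<open>s\<close>. By symmetry it is enough that one outer
  neighbour forms no triangle with them.\<close>

lemma ramsey_bounded_cubic_triangle:
  assumes fin: "finite V" and bl: "block E V" and deg: "\<And>v. v \<in> V \<Longrightarrow> card (nbh E V v) = 3" and card: "card V = 8"
    and abc: "a \<in> V" "b \<in> V" "c \<in> V" "E a b" "E b c" "E a c"
  shows "ramsey_bounded E 3 V"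
proof (cases "\<exists>a d e f. a \<in> V \<and> nbh E V a = {d, e, f} \<and> d \<noteq> e \<and> d \<noteq> f \<and> e \<noteq> f \<and> E d e \<and> E d f")
  case True
  then show ?thesis using ramsey_bounded_cubic_diamond[OF fin bl deg card] by blast
next
  case False
  have ne: "a \<noteq> b" "b \<noteq> c" "a \<noteq> c" using abc irrefl by auto
  have third: "\<exists>u'. nbh E V u = {v, w, u'} \<and> u' \<noteq> v \<and> u' \<noteq> w"
    if "u \<in> V" "v \<in> V" "w \<in> V" "E u v" "E u w" "v \<noteq> w" for u v w
  proof -
    have vw: "v \<in> nbh E V u" "w \<in> nbh E V u" using that by (auto simp: nbh_def)
    have "card (nbh E V u) = 3" by (rule deg[OF that(1)])
    from card_3_containing[OF this vw(1)]
    obtain d d' where c: "nbh E V u = {v, d, d'}" "d \<noteq> v" "d' \<noteq> v" "d \<noteq> d'" .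
    then have "w = d \<or> w = d'" using vw(2) that(6) by auto
    then show ?thesis
    proof
      assume "w = d"
      then show ?thesis using c by (intro exI[of _ d']) auto
    next
      assume "w = d'"
      then show ?thesis using c by (intro exI[of _ d]) auto
    qed
  qed
  obtain a' where Na: "nbh E V a = {b, c, a'}" "a' \<noteq> b" "a' \<noteq> c" using third[OF abc(1-3)] abc ne by blast
  obtain b' where Nb: "nbh E V b = {a, c, b'}" "b' \<noteq> a" "b' \<noteq> c"
    using third[OF abc(2,1,3)] abc ne sym by blast
  obtain c' where Nc: "nbh E V c = {a, b, c'}" "c' \<noteq> a" "c' \<noteq> b"
    using third[OF abc(3,1,2)] abc ne sym by blast
  have V': "a' \<in> V" "b' \<in> V" "c' \<in> V" "a' \<noteq> a" "b' \<noteq> b" "c' \<noteq> c" "E a a'" "E b b'" "E c c'"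
    using nbhE[OF Na(1), of a'] nbhE[OF Nb(1), of b'] nbhE[OF Nc(1), of c'] by simp_all
  have no: "\<not> (u \<in> V \<and> nbh E V u = {d, e, f} \<and> d \<noteq> e \<and> d \<noteq> f \<and> e \<noteq> f \<and> E d e \<and> E d f)" for u d e f
    using False by blast
  have "a' \<noteq> b'" using no[of a b c a'] Na abc V' ne by auto
  moreover have "a' \<noteq> c'"
  proof
    assume "a' = c'"
    moreover have "nbh E V a = {c, b, a'}" using Na(1) by auto
    ultimately show False using no[of a c b a'] Na(2,3) abc V' ne sym by blast
  qed
  moreover have "b' \<noteq> c'"
  proof
    assume "b' = c'"
    moreover have "nbh E V b = {c, a, b'}" using Nb(1) by auto
    ultimately show False using no[of b c a b'] Nb(2,3) abc V' ne sym by blast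
  qed
  ultimately have dist: "distinct [a, b, c, a', b', c']" using Na Nb Nc V' ne by auto
  let ?S = "{a, b, c, a', b', c'}"
  have "card ?S = 6" using dist by simp
  then have "card (V - ?S) = 2" using card fin abc V' by (subst card_Diff_subset) auto
  then obtain r s where rs: "V - ?S = {r, s}" "r \<noteq> s" by (auto simp: card_2_iff)
  have "?S \<subseteq> V" using abc(1-3) V'(1-3) by simp
  then have "V = ?S \<union> (V - ?S)" by blast
  then have V_eq: "V = {a, b, c, a', b', c', r, s}" unfolding rs(1) by auto
  have rsV: "r \<in> V" "s \<in> V" "r \<notin> ?S" "s \<notin> ?S" using rs by auto
  then have dist8: "distinct [a, b, c, a', b', c', r, s]" using dist rs(2) by auto
  \<comment> \<open>Otherwise \<open>r\<close> would have the four neighbours \<open>a'\<close>,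
    \<open>b'\<close>, \<open>c'\<close> and \<open>s\<close>.\<close>
  have "\<not> (E a' r \<and> E r s \<and> E a' s) \<or> \<not> (E b' r \<and> E r s \<and> E b' s) \<or> \<not> (E c' r \<and> E r s \<and> E c' s)"
  proof (rule ccontr)
    assume "\<not> ?thesis"
    then have "{a', b', c', s} \<subseteq> nbh E V r" using V' rsV sym by (auto simp: nbh_def)
    then have "card {a', b', c', s} \<le> card (nbh E V r)" by (rule card_mono[OF finite_nbh[OF fin]])
    then show False using deg[OF rsV(1)] dist8 by simp
  qed
  then consider "\<not> (E a' r \<and> E r s \<and> E a' s)" | "\<not> (E b' r \<and> E r s \<and> E b' s)" | "\<not> (E c' r \<and> E r s \<and> E c' s)"
    by blast
  then show ?thesis
  proof cases
    case 1
    have "V = {b, c, a, b', c', a', r, s}" "nbh E V b = {c, a, b'}" "nbh E V c = {b, a, c'}" "nbh E V a = {b, c, a'}"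
      using V_eq Na(1) Nb(1) Nc(1) by auto
    from ramsey_bounded_cubic_triangle_aux[OF fin this(1) _ this(2-4) 1] show ?thesis using dist8 by auto
  next
    case 2
    have "V = {a, c, b, a', c', b', r, s}" "nbh E V a = {c, b, a'}" "nbh E V c = {a, b, c'}" "nbh E V b = {a, c, b'}"
      using V_eq Na(1) Nb(1) Nc(1) by auto
    from ramsey_bounded_cubic_triangle_aux[OF fin this(1) _ this(2-4) 2] show ?thesis using dist8 by auto
  next
    case 3
    from ramsey_bounded_cubic_triangle_aux[OF fin V_eq dist8 Na(1) Nb(1) Nc(1) 3] show ?thesis .
  qed
qed

text \<open>A vertex \<open>v\<close> of a block with \<open>2 * degree\<close> at least the excess
  leaves excess at most 2, within reach of the quadratic bound. If there is none, all degrees are 2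
  or 3 and the excess is exactly 8.\<close>

lemma ramsey_bounded_cubic_power:
  assumes "finite V" "sparse E 8 V"
  shows "ramsey_bounded E 3 V"
proof (rule ramsey_bounded_by_blocks[where P = "sparse E 8"])
  fix V assume V: "finite V" "sparse E 8 V" "block E V"
  consider "V = {}" | v where "v \<in> V" "excess E V \<le> 2 * int (card (nbh E V v))"
    | "V \<noteq> {}" "\<forall>v\<in>V. 2 * int (card (nbh E V v)) < excess E V"
    by (meson not_less)
  then show "ramsey_bounded E 3 V"
  proof cases
    case 1
    then show ?thesis by (simp add: ramsey_bounded_empty)
  next
    case 2
    have "sparse E 2 (V - {v})"
      by (rule sparse_le[OF block_remove_sparse[OF V(3,1) 2(1)]]) (use 2(2) in simp)
    then have "ramsey_bounded E 2 (V - {v})" by (rule ramsey_bounded_quadratic[OF finite_Diff[OF V(1)]])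
    then have "ramsey_bounded E (Suc 2) V" by (rule ramsey_bounded_apex[OF sgraph_axioms _ 2(1)])
    then show ?thesis by (simp add: numeral_3_eq_3 numeral_2_eq_2)
  next
    case 3
    have le8: "excess E V \<le> 8" using V(2) 3(1) by (simp add: sparse_def)
    have deg: "card (nbh E V v) = 2 \<or> card (nbh E V v) = 3" if "v \<in> V" for v
      using block_degree[OF V(3) that] 3(2)[rule_format, OF that] le8 by linarith
    obtain u where "u \<in> V" using 3(1) by blast
    then have "0 < excess E V" using 3(2) by (metis less_le_trans not_less of_nat_0_le_iff mult_nonneg_nonneg zero_le_numeral)
    then obtain v where "v \<in> V" "3 \<le> card (nbh E V v)" by (rule excess_pos_degree)
    \<comment> \<open>A vertex of degree 3 exists and satisfies the strict inequality, so the excess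
      exceeds 6; parity and the upper bound leave only 8.\<close>
    then have "6 < excess E V" using 3(2) by fastforce
    moreover have "even (excess E V)" using V(1) by (rule even_excess)
    ultimately have ex: "excess E V = 8" using le8 by presburger
    show ?thesis
    proof (cases "\<exists>v\<in>V. card (nbh E V v) = 2")
      case True
      show ?thesis by (rule ramsey_bounded_cubic_subdivided[OF V(1,3) ex deg True])
    next
      case False
      then have deg3: "card (nbh E V v) = 3" if "v \<in> V" for v using deg[OF that] that by blast
      have "excess E V = int (card V)" unfolding excess_def by (simp add: deg3)
      then have c8: "card V = 8" using ex by simp
      show ?thesis
      proof (cases "\<exists>a\<in>V. \<exists>b\<in>V. \<exists>c\<in>V. E a b \<and> E b c \<and> E a c")
        case True
        then show ?thesis using ramsey_bounded_cubic_triangle[OF V(1,3) deg3 c8] by blast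
      next
        case False
        then show ?thesis by (intro ramsey_bounded_cubic_triangle_free[OF V(1) deg3 c8]) blast+
      qed
    qed
  qed
qed (simp_all add: assms, rule sparse_subset)

end

section \<open>Transfer to pair graphs and Ramsey numbers\<close>

lemma card_parcs_le:
  assumes "finite (parcs H)"
  shows "card (parcs H) \<le> 2 * card (edges H)"
proof -
  let ?f = "\<lambda>(u, v). {u, v}"
  have fibre: "card {a \<in> parcs H. ?f a = e} \<le> 2" if "e \<in> edges H" for e
  proof -
    from that obtain a where "e = ?f a" unfolding edges_def by blast
    moreover obtain u v where "a = (u, v)" by (cases a)
    ultimately have e: "e = {u, v}" by simp
    have "{a \<in> parcs H. ?f a = e} \<subseteq> {(u, v), (v, u)}"
    proof
      fix b assume "b \<in> {a \<in> parcs H. ?f a = e}"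
      then have b: "?f b = {u, v}" using e by simp
      obtain x y where "b = (x, y)" by (cases b)
      with b show "b \<in> {(u, v), (v, u)}" by (simp add: doubleton_eq_iff)
    qed
    from card_mono[OF _ this] have "card {a \<in> parcs H. ?f a = e} \<le> card {(u, v), (v, u)}" by simp
    also have "\<dots> \<le> Suc (card {(v, u)})" by (rule card_insert_le_m1) simp_all
    also have "\<dots> = 2" by simp
    finally show ?thesis .
  qed
  have "card (parcs H) = (\<Sum>e\<in>edges H. card {a \<in> parcs H. ?f a = e})"
    using sum.image_gen[OF assms, of "\<lambda>_. 1 :: nat" ?f] by (simp add: edges_def)
  also have "\<dots> \<le> (\<Sum>e\<in>edges H. 2)" by (rule sum_mono[OF fibre])
  also have "\<dots> = 2 * card (edges H)" by simp
  finally show ?thesis .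
qed

lemma pair_graph_sgraph:
  assumes "pair_graph H"
  shows "sgraph (\<lambda>u v. (u, v) \<in> parcs H)"
proof
  interpret H: pair_graph H by fact
  show "(v, u) \<in> parcs H" if "(u, v) \<in> parcs H" for u v using that by (rule H.arcs_symmetric)
  show "(u, u) \<notin> parcs H" for u using H.pair_no_loops[of "(u, u)"] by auto
qed

text \<open>Connectedness in the library is reachability in the symmetric closure, which has the
  same arcs here. A walk from \<open>s\<close> to \<open>t\<close> would have to cross from
  \<open>S\<close> to its complement.\<close>

lemma connected_in_parcs:
  assumes "pair_graph H" "Digraph_Component.connected (with_proj H)"
  shows "connected_in (\<lambda>u v. (u, v) \<in> parcs H) (pverts H)"
  unfolding connected_in_def
proof (intro allI impI)
  interpret H: pair_graph H by fact
  fix S assume S: "S \<subseteq> pverts H" "S \<noteq> {}" "S \<noteq> pverts H"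
  then obtain s t where s: "s \<in> S" and t: "t \<in> pverts H" "t \<notin> S" by blast
  show "\<exists>u\<in>S. \<exists>v\<in>pverts H - S. (u, v) \<in> parcs H"
  proof (rule ccontr)
    assume neg: "\<not> ?thesis"
    have parcs: "parcs (mk_symmetric (with_proj H)) = parcs H"
      using H.arcs_symmetric by (auto simp: parcs_mk_symmetric)
    have "s \<rightarrow>\<^sup>*\<^bsub>with_proj (mk_symmetric (with_proj H))\<^esub> t"
      using assms(2) s t(1) S(1) unfolding connected_def strongly_connected_def by auto
    then have "(s, t) \<in> rtrancl_on (pverts H) (parcs H)"
      by (simp add: reachable_def parcs)
    then have "t \<in> S"
    proof (induction rule: rtrancl_on_induct)
      case base
      show ?case by (rule s)
    next
      case (step x y)
      then show ?case using neg by blast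
    qed
    then show False using t by blast
  qed
qed

theorem theorem1p2:
  fixes H :: "'a pair_pre_digraph"
  assumes "pair_graph H"
    and "Digraph_Component.connected (with_proj H)"
    and "int (card (edges H)) - int (card (pverts H)) \<le> 4"
  shows "\<exists>C::real. \<forall>n\<ge>1. real (ramsey_number H (complete_graph n)) \<le> C * real n ^ 3"
proof -
  interpret H: pair_graph H by fact
  let ?E = "\<lambda>u v. (u, v) \<in> parcs H"
  have E: "sgraph ?E" by (rule pair_graph_sgraph) fact
  have fin: "finite (pverts H)" by (rule H.pair_finite_verts)
  \<comment> \<open>The degrees sum to the number of arcs, at most twice the number of edges; so e -
    v <= 4 turns into excess at most 8.\<close>
  have "excess ?E (pverts H) = int (\<Sum>v\<in>pverts H. card (nbh ?E (pverts H) v)) - 2 * int (card (pverts H))"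
    by (simp add: excess_def sum_subtractf)
  also have "(\<Sum>v\<in>pverts H. card (nbh ?E (pverts H) v)) = card (parcs H)"
  proof -
    have "{(a, b). a \<in> pverts H \<and> b \<in> pverts H \<and> (a, b) \<in> parcs H} = parcs H"
      using H.in_arcsD1 H.in_arcsD2 by auto
    then show ?thesis using card_pairs[OF fin, of ?E] by (simp add: nbh_def)
  qed
  finally have "excess ?E (pverts H) \<le> 8"
    using card_parcs_le[OF H.pair_finite_arcs] assms(3) by linarith
  then have "sparse ?E 8 (pverts H)"
    using sgraph.excess_mono[OF E connected_in_parcs[OF assms(1,2)] fin]
    unfolding sparse_def by (meson order_trans)
  then have "ramsey_bounded ?E 3 (pverts H)" by (rule sgraph.ramsey_bounded_cubic_power[OF E fin])
  then obtain C where C: "\<And>n A W. n \<ge> 1 \<Longrightarrow> sgraph A \<Longrightarrow> indep_free A n W \<Longrightarrow> C * n ^ 3 \<le> card W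
    \<Longrightarrow> \<exists>g. is_emb ?E (pverts H) (A :: nat \<Rightarrow> nat \<Rightarrow> bool) W g"
    by (rule ramsey_boundedE) metis
  \<comment> \<open>The Ramsey number is a least \<open>N\<close>, so it is enough to verify the
    property for hosts with exactly \<open>C * n ^ 3\<close> vertices. A host that is not
    \<open>indep_free\<close> contains an independent \<open>n\<close>-set, a clique of the
    complement.\<close>
  have "ramsey_number H (complete_graph n) \<le> C * n ^ 3" if n: "n \<ge> 1" for n
    unfolding ramsey_number_def
  proof (rule Least_le, unfold ramsey_property_def, intro allI impI)
    fix G :: "nat pair_pre_digraph"
    assume G: "pair_graph G \<and> card (pverts G) = C * n ^ 3"
    then interpret G: pair_graph G by simp
    let ?A = "\<lambda>u v. (u, v) \<in> parcs G"
    have K: "pair_graph (complete_graph n)" by (rule pair_graphI) (auto simp: complete_graph_def)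
    show "contains_copy G H \<or> contains_copy (complement G) (complete_graph n)"
    proof (cases "indep_free ?A n (pverts G)")
      case True
      moreover have "sgraph ?A" by (rule pair_graph_sgraph[OF G.pair_graph_axioms])
      ultimately obtain g where g: "is_emb ?E (pverts H) ?A (pverts G) g" using C[OF n, of ?A "pverts G"] G by auto
      have "(g u, g v) \<in> parcs G" if "(u, v) \<in> parcs H" for u v
        using g that H.in_arcsD1[OF that] H.in_arcsD2[OF that] by (simp add: is_emb_def)
      then have "contains_copy G H"
        unfolding contains_copy_iff_inj[OF G.pair_graph_axioms assms(1)]
        using g by (intro exI[of _ g]) (simp add: is_emb_def)
      then show ?thesis ..
    next
      case False
      then obtain S where S: "S \<subseteq> pverts G" "card S = n" "\<And>u v. u \<in> S \<Longrightarrow> v \<in> S \<Longrightarrow> (u, v) \<notin> parcs G"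
        using G.pair_finite_verts unfolding indep_free_def by blast
      have "contains_copy (complement G) (complete_graph n)"
        by (rule contains_copy_if_clique[OF pair_graph_complement[OF G.pair_graph_axioms] K, of S])
          (use S in \<open>auto simp: complement_def complete_graph_def\<close>)
      then show ?thesis ..
    qed
  qed
  then have "real (ramsey_number H (complete_graph n)) \<le> real (C * n ^ 3)" if "n \<ge> 1" for n
    using that by (simp only: of_nat_le_iff)
  then show ?thesis by (intro exI[of _ "real C"]) simp
qed

end
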